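(* Let $\mathbf{U}_l,\mathbf{V}_l,\mathbf{N}_l,\mathbf{M}_l,\mathbf{U}_r,\mathbf{V}_r,\mathbf{N}_r,\mathbf{M}_r\in\mathcal{RH}_\infty$ be a doubly-coprime factorization of the plant $\mathbf{G}$, so that in particular $\mathbf{G}=\mathbf{M}_l^{-1}\mathbf{N}_l$. Then the set of internally stabilizing controllers of $\mathbf{G}$ is $$\mathcal{C}_{\mathrm{stab}}=\{\mathbf{K}=\mathbf{Y}\mathbf{X}^{-1}\;:\;\mathbf{M}_l\mathbf{X}-\mathbf{N}_l\mathbf{Y}=I,\ \mathbf{X}\in\mathcal{RH}_\infty,\ \mathbf{Y}\in\mathcal{RH}_\infty\}.$$
   Context: $\mathcal{RH}_\infty$ denotes the set of real-rational proper stable transfer matrices in discrete time (all poles in the open unit disc), of whatever dimensions are compatible. Plant: $x[t+1]=A_p x[t]+B_p u[t]+\delta_x[t]$, $y[t]=C_p x[t]+\delta_y[t]$, with $x[t]\in\mathbb{R}^n$, $u[t]\in\mathbb{R}^m$, $y[t]\in\mathbb{R}^p$, where $(A_p,B_p)$ is stabilizable and $(C_p,A_p)$ is detectable. Its transfer matrix is the strictly proper $\mathbf{G}(z)=C_p(zI-A_p)^{-1}B_p$. Controller: a proper LTI controller $\mathbf{u}=\mathbf{K}\mathbf{y}+\delta_{\mathbf{u}}$ with state-space realization $\xi[t+1]=A_K\xi[t]+B_K y[t]$, $u[t]=C_K\xi[t]+D_K y[t]+\delta_u[t]$, $\xi[t]\in\mathbb{R}^q$ (any $q$). The realization is taken stabilizable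 and detectable. $\mathbf{K}$ internally stabilizes $\mathbf{G}$ if the closed loop is well-posed (automatic here, as the plant is strictly proper) and, with all disturbances $\delta_x,\delta_y,\delta_u$ zero, $(x[t],\xi[t])\to 0$ as $t\to\infty$ for all initial states. $\mathcal{C}_{\mathrm{stab}}$ is the set of all LTI controllers $\mathbf{K}$ (identified with their transfer matrices) that internally stabilize $\mathbf{G}$. Doubly-coprime factorization of $\mathbf{G}$: a collection $\mathbf{U}_l,\mathbf{V}_l,\mathbf{N}_l,\mathbf{M}_l,\mathbf{U}_r,\mathbf{V}_r,\mathbf{N}_r,\mathbf{M}_r\in\mathcal{RH}_\infty$ such that $\mathbf{G}=\mathbf{N}_r\mathbf{M}_r^{-1}=\mathbf{M}_l^{-1}\mathbf{N}_l$ and $$\begin{bmatrix}\mathbf{U}_l&-\mathbf{V}_l\\-\mathbf{N}_l&\mathbf{M}_l\end{bmatrix}\begin{bmatrix}\mathbf{M}_r&\mathbf{V}_r\\\mathbf{N}_r&\mathbf{U}_r\end{bmatrix}=I.$$ *)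

theory Defs
  imports
    Complex_Main
    "HOL-Computational_Algebra.Polynomial_Factorial"
    "HOL-Computational_Algebra.Field_as_Ring"
    "Jordan_Normal_Form.Char_Poly"
    "Jordan_Normal_Form.Gauss_Jordan_Elimination"
begin

text \<open>
  Real-rational functions in the indeterminate \<open>z\<close> are elements of \<open>real poly fract\<close>; transfer
  matrices are matrices over this field.
\<close>

type_synonym tmat = "real poly fract mat"

abbreviation indet_z :: "real poly fract" where
  "indet_z \<equiv> to_fract [:0, 1:]"

definition const_tmat :: "real mat \<Rightarrow> tmat" where
  "const_tmat = map_mat (\<lambda>a. to_fract [:a:])"

text \<open>Only meaningful for invertible matrices.\<close>

definition minv :: "'a :: field mat \<Rightarrow> 'a mat" where
  "minv M = the (mat_inverse M)"

lemma minv_inverts: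
  fixes M :: "'a :: field mat"
  assumes M: "M \<in> carrier_mat k k" and inv: "invertible_mat M"
  shows "minv M \<in> carrier_mat k k" "M * minv M = 1\<^sub>m k" "minv M * M = 1\<^sub>m k"
proof -
  obtain B where B: "M * B = 1\<^sub>m k" "B * M = 1\<^sub>m (dim_row B)"
    using inv M unfolding invertible_mat_def inverts_mat_def by auto
  have "dim_col B = k"
    using arg_cong[OF B(1), of dim_col] by simp
  moreover have "dim_row B = k"
    using arg_cong[OF B(2), of dim_col] M by simp
  ultimately have "B \<in> carrier_mat k k" by auto
  with B M have "M \<in> Units (ring_mat TYPE('a) k ())"
    by (auto simp: Units_def ring_mat_def)
  with mat_inverse(1)[OF M, of "()"] obtain Z where Z: "mat_inverse M = Some Z"
    by (cases "mat_inverse M") auto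
  from mat_inverse(2)[OF M Z] Z
  show "minv M \<in> carrier_mat k k" "M * minv M = 1\<^sub>m k" "minv M * M = 1\<^sub>m k"
    by (auto simp: minv_def)
qed

definition transfer_matrix :: "real mat \<Rightarrow> real mat \<Rightarrow> real mat \<Rightarrow> real mat \<Rightarrow> tmat" where
  "transfer_matrix A B C D =
     const_tmat C * minv (indet_z \<cdot>\<^sub>m 1\<^sub>m (dim_row A) - const_tmat A) * const_tmat B + const_tmat D"

text \<open>
  \<^const>\<open>quot_of_fract\<close> yields the numerator and denominator in lowest terms, so the roots of
  the denominator are exactly the poles.
\<close>

definition is_rational_pole :: "real poly fract \<Rightarrow> complex \<Rightarrow> bool" where
  "is_rational_pole f w \<longleftrightarrow> poly (map_poly complex_of_real (snd (quot_of_fract f))) w = 0"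

definition proper :: "real poly fract \<Rightarrow> bool" where
  "proper f \<longleftrightarrow> degree (fst (quot_of_fract f)) \<le> degree (snd (quot_of_fract f))"

definition RH_inf :: "nat \<Rightarrow> nat \<Rightarrow> tmat set" where
  "RH_inf k l = {M \<in> carrier_mat k l.
     \<forall>i < k. \<forall>j < l. proper (M $$ (i, j)) \<and> (\<forall>w. is_rational_pole (M $$ (i, j)) w \<longrightarrow> cmod w < 1)}"

definition schur_stable :: "real mat \<Rightarrow> bool" where
  "schur_stable A \<longleftrightarrow> (\<forall>w. eigenvalue (map_mat complex_of_real A) w \<longrightarrow> cmod w < 1)"

definition stabilizable :: "real mat \<Rightarrow> real mat \<Rightarrow> bool" where
  "stabilizable A B \<longleftrightarrow> (\<exists>F \<in> carrier_mat (dim_col B) (dim_row A). schur_stable (A + B * F))"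

definition detectable :: "real mat \<Rightarrow> real mat \<Rightarrow> bool" where
  "detectable C A \<longleftrightarrow> (\<exists>L \<in> carrier_mat (dim_row A) (dim_row C). schur_stable (A + L * C))"

definition plant_eqs ::
  "nat \<Rightarrow> nat \<Rightarrow> nat \<Rightarrow> real mat \<Rightarrow> real mat \<Rightarrow> real mat \<Rightarrow> (nat \<Rightarrow> real vec) \<Rightarrow> (nat \<Rightarrow> real vec) \<Rightarrow>
   (nat \<Rightarrow> real vec) \<Rightarrow> (nat \<Rightarrow> real vec) \<Rightarrow> (nat \<Rightarrow> real vec) \<Rightarrow> bool" where
  "plant_eqs n m p A\<^sub>p B\<^sub>p C\<^sub>p \<delta>x \<delta>y x u y \<longleftrightarrow>
     (\<forall>t. x t \<in> carrier_vec n \<and> u t \<in> carrier_vec m \<and> y t \<in> carrier_vec p \<and>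
        x (Suc t) = A\<^sub>p *\<^sub>v x t + B\<^sub>p *\<^sub>v u t + \<delta>x t \<and>
        y t = C\<^sub>p *\<^sub>v x t + \<delta>y t)"

definition controller_eqs ::
  "nat \<Rightarrow> nat \<Rightarrow> nat \<Rightarrow> real mat \<Rightarrow> real mat \<Rightarrow> real mat \<Rightarrow> real mat \<Rightarrow> (nat \<Rightarrow> real vec) \<Rightarrow>
   (nat \<Rightarrow> real vec) \<Rightarrow> (nat \<Rightarrow> real vec) \<Rightarrow> (nat \<Rightarrow> real vec) \<Rightarrow> bool" where
  "controller_eqs q m p A\<^sub>K B\<^sub>K C\<^sub>K D\<^sub>K \<delta>u \<xi> u y \<longleftrightarrow>
     (\<forall>t. \<xi> t \<in> carrier_vec q \<and> u t \<in> carrier_vec m \<and> y t \<in> carrier_vec p \<and>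
        \<xi> (Suc t) = A\<^sub>K *\<^sub>v \<xi> t + B\<^sub>K *\<^sub>v y t \<and>
        u t = C\<^sub>K *\<^sub>v \<xi> t + D\<^sub>K *\<^sub>v y t + \<delta>u t)"

definition vec_tendsto_zero :: "nat \<Rightarrow> (nat \<Rightarrow> real vec) \<Rightarrow> bool" where
  "vec_tendsto_zero k v \<longleftrightarrow> (\<forall>i < k. (\<lambda>t. v t $ i) \<longlonglongrightarrow> 0)"

text \<open>
  Well-posedness: at every instant, the states and the disturbances determine the loop signals
  \<open>u\<close> and \<open>y\<close> uniquely.
\<close>

definition well_posed ::
  "nat \<Rightarrow> nat \<Rightarrow> nat \<Rightarrow> nat \<Rightarrow> real mat \<Rightarrow> real mat \<Rightarrow> real mat \<Rightarrow> bool" where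
  "well_posed n m p q C\<^sub>p C\<^sub>K D\<^sub>K \<longleftrightarrow>
     (\<forall>x \<in> carrier_vec n. \<forall>\<xi> \<in> carrier_vec q. \<forall>\<delta>y \<in> carrier_vec p. \<forall>\<delta>u \<in> carrier_vec m.
        \<exists>!(u, y). u \<in> carrier_vec m \<and> y \<in> carrier_vec p \<and>
          y = C\<^sub>p *\<^sub>v x + \<delta>y \<and> u = C\<^sub>K *\<^sub>v \<xi> + D\<^sub>K *\<^sub>v y + \<delta>u)"

definition internally_stable_loop ::
  "nat \<Rightarrow> nat \<Rightarrow> nat \<Rightarrow> nat \<Rightarrow> real mat \<Rightarrow> real mat \<Rightarrow> real mat \<Rightarrow>
   real mat \<Rightarrow> real mat \<Rightarrow> real mat \<Rightarrow> real mat \<Rightarrow> bool" where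
  "internally_stable_loop n m p q A\<^sub>p B\<^sub>p C\<^sub>p A\<^sub>K B\<^sub>K C\<^sub>K D\<^sub>K \<longleftrightarrow>
     well_posed n m p q C\<^sub>p C\<^sub>K D\<^sub>K \<and>
     (\<forall>x \<xi> u y.
        plant_eqs n m p A\<^sub>p B\<^sub>p C\<^sub>p (\<lambda>_. 0\<^sub>v n) (\<lambda>_. 0\<^sub>v p) x u y \<and>
        controller_eqs q m p A\<^sub>K B\<^sub>K C\<^sub>K D\<^sub>K (\<lambda>_. 0\<^sub>v m) \<xi> u y \<longrightarrow>
        vec_tendsto_zero n x \<and> vec_tendsto_zero q \<xi>)"

definition C_stab :: "nat \<Rightarrow> nat \<Rightarrow> nat \<Rightarrow> real mat \<Rightarrow> real mat \<Rightarrow> real mat \<Rightarrow> tmat set" where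
  "C_stab n m p A\<^sub>p B\<^sub>p C\<^sub>p =
     {K. \<exists>q A\<^sub>K B\<^sub>K C\<^sub>K D\<^sub>K.
        A\<^sub>K \<in> carrier_mat q q \<and> B\<^sub>K \<in> carrier_mat q p \<and>
        C\<^sub>K \<in> carrier_mat m q \<and> D\<^sub>K \<in> carrier_mat m p \<and>
        stabilizable A\<^sub>K B\<^sub>K \<and> detectable C\<^sub>K A\<^sub>K \<and>
        K = transfer_matrix A\<^sub>K B\<^sub>K C\<^sub>K D\<^sub>K \<and>
        internally_stable_loop n m p q A\<^sub>p B\<^sub>p C\<^sub>p A\<^sub>K B\<^sub>K C\<^sub>K D\<^sub>K}"

definition doubly_coprime_factorization ::
  "nat \<Rightarrow> nat \<Rightarrow> tmat \<Rightarrow> tmat \<Rightarrow> tmat \<Rightarrow> tmat \<Rightarrow> tmat \<Rightarrow> tmat \<Rightarrow> tmat \<Rightarrow> tmat \<Rightarrow> tmat \<Rightarrow> bool" where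
  "doubly_coprime_factorization p m G U\<^sub>l V\<^sub>l N\<^sub>l M\<^sub>l U\<^sub>r V\<^sub>r N\<^sub>r M\<^sub>r \<longleftrightarrow>
     U\<^sub>l \<in> RH_inf m m \<and> V\<^sub>l \<in> RH_inf m p \<and> N\<^sub>l \<in> RH_inf p m \<and> M\<^sub>l \<in> RH_inf p p \<and>
     U\<^sub>r \<in> RH_inf p p \<and> V\<^sub>r \<in> RH_inf m p \<and> N\<^sub>r \<in> RH_inf p m \<and> M\<^sub>r \<in> RH_inf m m \<and>
     invertible_mat M\<^sub>r \<and> invertible_mat M\<^sub>l \<and>
     G = N\<^sub>r * minv M\<^sub>r \<and> G = minv M\<^sub>l * N\<^sub>l \<and>
     four_block_mat U\<^sub>l (- V\<^sub>l) (- N\<^sub>l) M\<^sub>l * four_block_mat M\<^sub>r V\<^sub>r N\<^sub>r U\<^sub>r = 1\<^sub>m (m + p)"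

end

theory Submission
  imports Defs "Jordan_Normal_Form.Spectral_Radius"
begin

text \<open>
  A controller \<open>K\<close> stabilizes the plant if and only if \<open>K = Y X^-1\<close> for a stable solution of the Bezout
  equation \<open>M\<^sub>l X - N\<^sub>l Y = I\<close>. Both directions use state equations \<open>z s = A s + T\<close> over the field of
  rational functions, which have a unique solution for every real \<open>A\<close>, and a stable one if \<open>A\<close> is Schur
  stable and \<open>T\<close> is stable (lemmas \<open>state_equation_iff\<close> and \<open>resolvent_stable\<close>).

  Suppose that \<open>K\<close> stabilizes the plant. All trajectories of the loop converge, so the closed-loop state
  matrix is Schur stable. By the Bezout identity \<open>M\<^sub>l U\<^sub>r - N\<^sub>l V\<^sub>r = I\<close>, one may take for \<open>X\<close> the
  measured output and for \<open>Y\<close> the controller output when the stable signal \<open>- V\<^sub>r\<close> is injected at the plant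
  input and \<open>U\<^sub>r\<close> at the plant output; both are stable, and \<open>Y = K X\<close> (lemma \<open>stabilizing_controller_factor\<close>).

  Conversely, let \<open>(X, Y)\<close> solve the Bezout equation. A stabilizable and detectable realization of
  \<open>Y X^-1\<close> has to be found. The Youla parametrization provides one without minimal realizations or pole
  placement: relative to a stabilizing state feedback \<open>F\<close> and
  observer gain \<open>L\<close> of the plant, \<open>(X, Y)\<close> is determined, up to an invertible right factor, by a stable
  parameter \<open>Q\<close> (lemma \<open>youla_parameter\<close>). A stable transfer matrix has a realization with a Schur
  stable state matrix, by companion matrices (lemma \<open>RH_inf_schur_realizable\<close>). The observer-based
  controller that feeds the estimation error through this realization of \<open>Q\<close> has transfer matrix \<open>Y X^-1\<close>;
  its feedback and observer structure provides the gains that witness stabilizability and detectability,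
  and the separation principle yields internal stability (locale \<open>observer_controller\<close>). The argument
  also shows that \<open>X\<close> is invertible, which the Bezout equation does not say outright.
\<close>

section \<open>Stable proper rational functions\<close>

definition stable_fract :: "real poly fract \<Rightarrow> bool" where
  "stable_fract f \<longleftrightarrow> proper f \<and> (\<forall>w. is_rational_pole f w \<longrightarrow> cmod w < 1)"

definition schur_poly :: "real poly \<Rightarrow> bool" where
  "schur_poly b \<longleftrightarrow> b \<noteq> 0 \<and> (\<forall>w. poly (map_poly complex_of_real b) w = 0 \<longrightarrow> cmod w < 1)"

lemma map_poly_of_real_mult:
  "map_poly complex_of_real (a * b) = map_poly complex_of_real a * map_poly complex_of_real b"
proof -
  interpret h: map_poly_comm_ring_hom complex_of_real ..
  show ?thesis by (rule h.hom_mult)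
qed

lemma schur_poly_mult: "schur_poly (a * b) \<longleftrightarrow> schur_poly a \<and> schur_poly b"
  by (auto simp: schur_poly_def map_poly_of_real_mult)

lemma schur_poly_one: "schur_poly 1" by (simp add: schur_poly_def)

text \<open>
  The defining condition speaks of the representation in lowest terms, which is awkward under sums and
  products. Any representation will do: the reduced denominator divides every other denominator, so
  cancelling common factors can only remove poles, and it lowers both degrees by the same amount.
\<close>

lemma stable_fract_iff:
  "stable_fract f \<longleftrightarrow>
     (\<exists>a b. f = to_fract a / to_fract b \<and> degree a \<le> degree b \<and> schur_poly b)"
proof
  assume "stable_fract f"
  then have "degree (fst (quot_of_fract f)) \<le> degree (snd (quot_of_fract f))"
    and "schur_poly (snd (quot_of_fract f))"
    by (auto simp: stable_fract_def proper_def is_rational_pole_def schur_poly_def)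
  moreover have "f = to_fract (fst (quot_of_fract f)) / to_fract (snd (quot_of_fract f))"
    by (metis Fract_conv_to_fract Fract_quot_of_fract)
  ultimately show "\<exists>a b. f = to_fract a / to_fract b \<and> degree a \<le> degree b \<and> schur_poly b"
    by blast
next
  assume "\<exists>a b. f = to_fract a / to_fract b \<and> degree a \<le> degree b \<and> schur_poly b"
  then obtain a b where f: "f = to_fract a / to_fract b" and deg: "degree a \<le> degree b"
    and b: "schur_poly b" by blast
  define c d where "c = fst (quot_of_fract f)" and "d = snd (quot_of_fract f)"
  have f': "f = to_fract c / to_fract d" unfolding c_def d_def
    by (metis Fract_conv_to_fract Fract_quot_of_fract)
  have d0: "d \<noteq> 0" by (simp add: d_def)
  have b0: "b \<noteq> 0" using b by (simp add: schur_poly_def)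
  have "to_fract (c * b) = to_fract (a * d)"
    using f f' d0 b0 by (simp add: field_simps)
  then have cb: "c * b = a * d" by (simp only: to_fract_eq_iff)
  have "coprime c d" unfolding c_def d_def by (rule coprime_quot_of_fract)
  moreover have "d dvd c * b" using cb by simp
  ultimately have "d dvd b" by (metis coprime_commute coprime_dvd_mult_right_iff)
  then obtain k where k: "b = d * k" by blast
  have ak: "a = c * k" using cb k d0 by (simp add: algebra_simps)
  have "k \<noteq> 0" using b0 k by auto
  have "degree c \<le> degree d"
  proof (cases "c = 0")
    case False
    then show ?thesis using deg ak k d0 \<open>k \<noteq> 0\<close> by (simp add: degree_mult_eq)
  qed simp
  moreover have "schur_poly d" using b k schur_poly_mult by simp
  ultimately show "stable_fract f"
    by (auto simp: stable_fract_def proper_def is_rational_pole_def schur_poly_def c_def d_def)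
qed

lemma stable_fract_const: "stable_fract (to_fract [:a:])"
  unfolding stable_fract_iff by (rule exI[of _ "[:a:]"], rule exI[of _ 1]) (simp add: schur_poly_one)

lemma stable_fract_add: "stable_fract f \<Longrightarrow> stable_fract g \<Longrightarrow> stable_fract (f + g)"
  and stable_fract_mult: "stable_fract f \<Longrightarrow> stable_fract g \<Longrightarrow> stable_fract (f * g)"
proof -
  assume "stable_fract f" "stable_fract g"
  then obtain a b c d where f: "f = to_fract a / to_fract b" "degree a \<le> degree b" "schur_poly b"
    and g: "g = to_fract c / to_fract d" "degree c \<le> degree d" "schur_poly d"
    unfolding stable_fract_iff by blast
  have nz: "b \<noteq> 0" "d \<noteq> 0" using f g by (auto simp: schur_poly_def)
  have bd: "schur_poly (b * d)" using f g by (simp add: schur_poly_mult)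
  have "f + g = to_fract (a * d + c * b) / to_fract (b * d)" using nz f g by (simp add: field_simps)
  moreover have "degree (a * d + c * b) \<le> degree (b * d)"
    using f(2) g(2) nz degree_mult_le[of a d] degree_mult_le[of c b]
    by (intro degree_add_le) (auto simp: degree_mult_eq)
  ultimately show "stable_fract (f + g)" unfolding stable_fract_iff using bd by blast
  have "f * g = to_fract (a * c) / to_fract (b * d)" using nz f g by (simp add: field_simps)
  moreover have "degree (a * c) \<le> degree (b * d)"
    using f(2) g(2) nz degree_mult_le[of a c] by (auto simp: degree_mult_eq)
  ultimately show "stable_fract (f * g)" unfolding stable_fract_iff using bd by blast
qed

lemma stable_fract_0: "stable_fract 0" using stable_fract_const[of 0] by simp

lemma stable_fract_uminus: "stable_fract f \<Longrightarrow> stable_fract (- f)"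
proof -
  have "to_fract [:-1:] = (-1 :: real poly fract)"
    by (metis minus_pCons minus_zero one_pCons to_fract_1 to_fract_uminus)
  then show "stable_fract f \<Longrightarrow> stable_fract (- f)"
    using stable_fract_mult[OF stable_fract_const[of "-1"], of f] by simp
qed

lemma stable_fract_diff: "stable_fract f \<Longrightarrow> stable_fract g \<Longrightarrow> stable_fract (f - g)"
  using stable_fract_add[OF _ stable_fract_uminus, of f g] by simp

lemma stable_fract_sum: "(\<And>i. i \<in> I \<Longrightarrow> stable_fract (f i)) \<Longrightarrow> stable_fract (sum f I)"
  by (induction I rule: infinite_finite_induct) (auto intro: stable_fract_0 stable_fract_add)

section \<open>Stable transfer matrices and constant matrices\<close>

lemma RH_inf_iff: "M \<in> RH_inf k l \<longleftrightarrow> M \<in> carrier_mat k l \<and> (\<forall>i<k. \<forall>j<l. stable_fract (M $$ (i, j)))"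
  by (auto simp: RH_inf_def stable_fract_def)

lemma RH_inf_carrier: "M \<in> RH_inf k l \<Longrightarrow> M \<in> carrier_mat k l" by (simp add: RH_inf_iff)

lemma RH_inf_add: "M \<in> RH_inf k l \<Longrightarrow> N \<in> RH_inf k l \<Longrightarrow> M + N \<in> RH_inf k l"
  by (auto simp: RH_inf_iff intro!: stable_fract_add)

lemma RH_inf_minus: "M \<in> RH_inf k l \<Longrightarrow> N \<in> RH_inf k l \<Longrightarrow> M - N \<in> RH_inf k l"
  by (auto simp: RH_inf_iff intro!: stable_fract_diff)

lemma RH_inf_mult: "M \<in> RH_inf k l \<Longrightarrow> N \<in> RH_inf l r \<Longrightarrow> M * N \<in> RH_inf k r"
  by (auto simp: RH_inf_iff scalar_prod_def intro!: stable_fract_sum stable_fract_mult)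

lemma RH_inf_const: "A \<in> carrier_mat k l \<Longrightarrow> const_tmat A \<in> RH_inf k l"
  by (auto simp: RH_inf_iff const_tmat_def intro: stable_fract_const)

lemma const_tmat_carrier [simp]: "const_tmat A \<in> carrier_mat k l \<longleftrightarrow> A \<in> carrier_mat k l"
  unfolding const_tmat_def by (rule map_carrier_mat)

lemma const_tmat_dim [simp]: "dim_row (const_tmat A) = dim_row A" "dim_col (const_tmat A) = dim_col A"
  by (auto simp: const_tmat_def)

lemma to_fract_const_add: "to_fract [:a + b:] = to_fract [:a:] + to_fract [:b :: real:]"
  and to_fract_const_diff: "to_fract [:a - b:] = to_fract [:a:] - to_fract [:b:]"
  and to_fract_const_mult: "to_fract [:a * b:] = to_fract [:a:] * to_fract [:b:]"
  and to_fract_const_uminus: "to_fract [:- a:] = - to_fract [:a:]"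
  by (simp_all only: to_fract_add[symmetric] to_fract_diff[symmetric] to_fract_mult[symmetric]
      to_fract_uminus[symmetric] to_fract_eq_iff) auto

lemma to_fract_const_sum: "to_fract [:sum f I:] = (\<Sum>i\<in>I. to_fract [:f i :: real:])"
  by (induction I rule: infinite_finite_induct) (auto simp: to_fract_const_add)

lemma const_tmat_add: "A \<in> carrier_mat k l \<Longrightarrow> B \<in> carrier_mat k l \<Longrightarrow>
    const_tmat (A + B) = const_tmat A + const_tmat B"
  unfolding const_tmat_def by (rule eq_matI) (auto simp: to_fract_const_add)

lemma const_tmat_minus: "A \<in> carrier_mat k l \<Longrightarrow> B \<in> carrier_mat k l \<Longrightarrow>
    const_tmat (A - B) = const_tmat A - const_tmat B"
  unfolding const_tmat_def by (rule eq_matI) (auto simp: to_fract_const_diff)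

lemma const_tmat_mult: "A \<in> carrier_mat k l \<Longrightarrow> B \<in> carrier_mat l r \<Longrightarrow>
    const_tmat (A * B) = const_tmat A * const_tmat B"
  unfolding const_tmat_def
  by (intro eq_matI) (auto simp: scalar_prod_def to_fract_const_sum to_fract_const_mult)

lemma const_tmat_zero: "const_tmat (0\<^sub>m k l) = 0\<^sub>m k l"
  unfolding const_tmat_def by (rule eq_matI) auto

lemma const_tmat_uminus: "const_tmat (- A) = - const_tmat A"
  unfolding const_tmat_def by (rule eq_matI) (auto simp: to_fract_const_uminus)

section \<open>The resolvent of a stable matrix\<close>

lemma schur_stable_iff: assumes "A \<in> carrier_mat n n"
  shows "schur_stable A \<longleftrightarrow> schur_poly (char_poly A)"
proof -
  have cr: "comm_ring_hom complex_of_real" by unfold_locales auto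
  have "char_poly A \<noteq> 0" using degree_monic_char_poly[OF assms] by (metis coeff_0 zero_neq_one)
  moreover have "eigenvalue (map_mat complex_of_real A) w \<longleftrightarrow>
      poly (map_poly complex_of_real (char_poly A)) w = 0" for w
    using eigenvalue_root_char_poly[of "map_mat complex_of_real A" n w] assms
      comm_ring_hom.char_poly_hom[OF cr assms] by auto
  ultimately show ?thesis by (simp add: schur_stable_def schur_poly_def)
qed

definition zI_minus :: "real mat \<Rightarrow> tmat" where
  "zI_minus A = indet_z \<cdot>\<^sub>m 1\<^sub>m (dim_row A) - const_tmat A"

definition resolvent :: "real mat \<Rightarrow> tmat" where
  "resolvent A = minv (zI_minus A)"

text \<open>
  Over a field a one-sided inverse of a square matrix is two-sided, so a single product identifies
  \<^const>\<open>minv\<close>.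
\<close>

lemma minv_unique:
  fixes M :: "'a :: field mat"
  assumes "M \<in> carrier_mat k k" "N \<in> carrier_mat k k" "M * N = 1\<^sub>m k"
  shows "invertible_mat M" "minv M = N"
proof -
  have NM: "N * M = 1\<^sub>m k" by (rule mat_mult_left_right_inverse[OF assms])
  show inv: "invertible_mat M" unfolding invertible_mat_def inverts_mat_def
    using assms NM by auto
  note mi = minv_inverts[OF assms(1) inv]
  have "minv M = minv M * (M * N)" using mi assms by simp
  also have "\<dots> = (minv M * M) * N"
    by (rule assoc_mult_mat[symmetric]) (use mi assms in auto)
  also have "\<dots> = N" using mi assms by simp
  finally show "minv M = N" .
qed

lemma zI_minus_eq: "A \<in> carrier_mat n n \<Longrightarrow> zI_minus A = map_mat to_fract (char_poly_matrix A)"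
  unfolding zI_minus_def char_poly_matrix_def const_tmat_def
  by (rule eq_matI) (auto simp: to_fract_const_uminus simp flip: to_fract_diff)

lemma to_fract_hom: "comm_ring_hom (to_fract :: real poly \<Rightarrow> _)"
  by unfold_locales auto

text \<open>
  Cramer's rule: \<open>z I - A\<close> is the characteristic matrix of \<open>A\<close>, and its determinant, being monic, is
  a nonzero polynomial. Hence \<open>z I - A\<close> is invertible over the rational functions for every real \<open>A\<close>,
  stable or not.
\<close>

lemma resolvent_eq:
  assumes A: "A \<in> carrier_mat n n"
  shows "resolvent A = inverse (to_fract (char_poly A)) \<cdot>\<^sub>m map_mat to_fract (adj_mat (char_poly_matrix A))"
    and "invertible_mat (zI_minus A)"
proof -
  interpret h: comm_ring_hom "to_fract :: real poly \<Rightarrow> _" by (rule to_fract_hom)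
  let ?c = "char_poly_matrix A"
  have c: "?c \<in> carrier_mat n n" using A by simp
  have nz: "char_poly A \<noteq> 0" using degree_monic_char_poly[OF A] by (metis coeff_0 zero_neq_one)
  have "map_mat to_fract ?c * map_mat to_fract (adj_mat ?c) = map_mat to_fract (char_poly A \<cdot>\<^sub>m 1\<^sub>m n)"
    using h.mat_hom_mult[OF c adj_mat(1)[OF c]] adj_mat(2)[OF c] by (simp add: char_poly_def)
  also have "\<dots> = to_fract (char_poly A) \<cdot>\<^sub>m 1\<^sub>m n" by (rule eq_matI) auto
  finally have e: "zI_minus A * map_mat to_fract (adj_mat ?c) = to_fract (char_poly A) \<cdot>\<^sub>m 1\<^sub>m n"
    by (simp add: zI_minus_eq[OF A])
  have Z: "zI_minus A \<in> carrier_mat n n" using c by (simp add: zI_minus_eq[OF A])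
  have ad: "map_mat to_fract (adj_mat ?c) \<in> carrier_mat n n" using adj_mat(1)[OF c] by simp
  have "zI_minus A * (inverse (to_fract (char_poly A)) \<cdot>\<^sub>m map_mat to_fract (adj_mat ?c)) = 1\<^sub>m n"
    using nz by (subst mult_smult_distrib[OF Z ad], subst e) auto
  from minv_unique[OF Z _ this] ad
  show "resolvent A = inverse (to_fract (char_poly A)) \<cdot>\<^sub>m map_mat to_fract (adj_mat ?c)"
    and "invertible_mat (zI_minus A)" by (auto simp: resolvent_def)
qed

lemma zI_minus_carrier: "A \<in> carrier_mat n n \<Longrightarrow> zI_minus A \<in> carrier_mat n n"
  by (simp add: zI_minus_eq)

lemma resolvent_inverse:
  assumes "A \<in> carrier_mat n n"
  shows "resolvent A \<in> carrier_mat n n" "zI_minus A * resolvent A = 1\<^sub>m n" "resolvent A * zI_minus A = 1\<^sub>m n"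
  using minv_inverts[OF zI_minus_carrier[OF assms] resolvent_eq(2)[OF assms]] by (auto simp: resolvent_def)

lemma degree_adj_char_poly_matrix:
  assumes A: "A \<in> carrier_mat n n" and ij: "i < n" "j < n"
  shows "degree (adj_mat (char_poly_matrix A) $$ (i, j)) \<le> n"
proof -
  let ?c = "char_poly_matrix A"
  have c: "?c \<in> carrier_mat n n" using A by simp
  have del: "mat_delete ?c j i \<in> carrier_mat (n - 1) (n - 1)" 
    using mat_delete_carrier[OF c] by simp
  have "degree (det (mat_delete ?c j i)) \<le> 1 * (n - 1)"
  proof (rule degree_det_le[OF _ del])
    fix r s assume "r < n - 1" "s < n - 1"
    then have "(if r < j then r else Suc r) < n" "(if s < i then s else Suc s) < n" by auto
    then show "degree (mat_delete ?c j i $$ (r, s)) \<le> 1"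
      using c A ij \<open>r < n - 1\<close> \<open>s < n - 1\<close>
      by (auto simp: mat_delete_def char_poly_matrix_def intro!: degree_add_le)
  qed
  then have "degree (cofactor ?c j i) \<le> n"
    using degree_mult_le[of "(-1)^(j+i)" "det (mat_delete ?c j i)"]
    by (cases "even (j + i)") (auto simp: cofactor_def)
  moreover have "dim_row ?c = n" "dim_col ?c = n" using c by auto
  ultimately show ?thesis using ij by (simp add: adj_mat_def)
qed

text \<open>
  In Cramer's formula the denominator is the characteristic polynomial, whose roots are the
  eigenvalues, and the cofactors in the numerator have no larger degree.
\<close>

lemma resolvent_stable:
  assumes A: "A \<in> carrier_mat n n" and s: "schur_stable A"
  shows "resolvent A \<in> RH_inf n n"
  unfolding RH_inf_iff
proof (intro conjI allI impI)
  fix i j assume ij: "i < n" "j < n"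
  have dims: "adj_mat (char_poly_matrix A) \<in> carrier_mat n n" by (rule adj_mat(1)[OF char_poly_matrix_closed[OF A]])
  have "resolvent A $$ (i, j) = to_fract (adj_mat (char_poly_matrix A) $$ (i, j)) / to_fract (char_poly A)"
    using ij A dims by (simp add: resolvent_eq[OF A] field_simps)
  moreover have "degree (adj_mat (char_poly_matrix A) $$ (i, j)) \<le> degree (char_poly A)"
    using degree_adj_char_poly_matrix[OF A ij] degree_monic_char_poly[OF A] by simp
  ultimately show "stable_fract (resolvent A $$ (i, j))"
    unfolding stable_fract_iff using s schur_stable_iff[OF A] by blast
qed (use resolvent_inverse(1)[OF A] in auto)

text \<open>
  The characteristic polynomial of a block triangular matrix is the product of those of the diagonal
  blocks.
\<close>

lemma schur_stable_block:
  assumes A: "A \<in> carrier_mat a a" and D: "D \<in> carrier_mat d d" and sA: "schur_stable A" and sD: "schur_stable D"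
  shows "B \<in> carrier_mat a d \<Longrightarrow> schur_stable (four_block_mat A B (0\<^sub>m d a) D)"
    and "C \<in> carrier_mat d a \<Longrightarrow> schur_stable (four_block_mat A (0\<^sub>m a d) C D)"
proof -
  have *: "char_poly_matrix (four_block_mat A B C D) = 
     four_block_mat (char_poly_matrix A) (map_mat (\<lambda>a. [:-a:]) B) (map_mat (\<lambda>a. [:-a:]) C) (char_poly_matrix D)"
    if "B \<in> carrier_mat a d" "C \<in> carrier_mat d a" for B C
    using A D that unfolding char_poly_matrix_def by (intro eq_matI) (auto simp: less_diff_conv)
  have z: "map_mat (\<lambda>a. [:-a:]) (0\<^sub>m i j) = (0\<^sub>m i j :: real poly mat)" for i j by (rule eq_matI) auto
  have cA: "char_poly_matrix A \<in> carrier_mat a a" and cD: "char_poly_matrix D \<in> carrier_mat d d"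
    using A D by auto
  { assume B: "B \<in> carrier_mat a d"
    have "char_poly (four_block_mat A B (0\<^sub>m d a) D) = char_poly A * char_poly D"
      unfolding char_poly_def *[OF B zero_carrier_mat] z
      by (rule det_four_block_mat_lower_left_zero[OF cA _ refl cD]) (use B in auto)
    then show "schur_stable (four_block_mat A B (0\<^sub>m d a) D)"
      using sA sD A D by (auto simp: schur_stable_iff[of _ "a + d"] schur_stable_iff schur_poly_mult) }
  { assume C: "C \<in> carrier_mat d a"
    have "char_poly (four_block_mat A (0\<^sub>m a d) C D) = char_poly A * char_poly D"
      unfolding char_poly_def *[OF zero_carrier_mat C] z
      by (rule det_four_block_mat_upper_right_zero[OF cA refl _ cD]) (use C in auto)
    then show "schur_stable (four_block_mat A (0\<^sub>m a d) C D)"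
      using sA sD A D by (auto simp: schur_stable_iff[of _ "a + d"] schur_stable_iff schur_poly_mult) }
qed

section \<open>Schur stability and convergence of trajectories\<close>

lemma orbit_eq_power:
  fixes M :: "'a :: comm_ring_1 mat"
  assumes M: "M \<in> carrier_mat n n" and y: "\<And>t. y t \<in> carrier_vec n" and step: "\<And>t. y (Suc t) = M *\<^sub>v y t"
  shows "y t = (M ^\<^sub>m t) *\<^sub>v y 0"
  using y step
proof (induction t arbitrary: y)
  case 0
  then show ?case using M by simp
next
  case (Suc t)
  have "y (Suc t) = (M ^\<^sub>m t) *\<^sub>v y (Suc 0)" by (rule Suc.IH) (rule Suc.prems)+
  also have "\<dots> = (M ^\<^sub>m t) *\<^sub>v (M *\<^sub>v y 0)" using Suc.prems by simp
  also have "\<dots> = (M ^\<^sub>m t * M) *\<^sub>v y 0"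
    by (rule assoc_mult_mat_vec[symmetric, of _ n n _ n]) (use M Suc.prems pow_carrier_mat in auto)
  finally show ?case by simp
qed

lemma spectral_radius_lt_1:
  assumes A: "A \<in> carrier_mat n n" and n: "n > 0" and ev: "\<And>w. eigenvalue A w \<Longrightarrow> cmod w < r"
  shows "spectral_radius A < r"
  using spectral_radius_mem_max(1)[OF A n] ev by (auto simp: spectrum_def)

text \<open>
  The Jordan normal form bounds the powers of a matrix of spectral radius below 1 by a constant. That
  alone does not give convergence, so it is applied to \<open>A / r\<close> for some \<open>r < 1\<close> above the spectral
  radius; then the powers of \<open>A\<close> decay like \<open>r ^ t\<close>.
\<close>

lemma schur_stable_trajectory:
  assumes A: "A \<in> carrier_mat n n" and s: "schur_stable A"
    and x: "\<And>t. x t \<in> carrier_vec n" and step: "\<And>t. x (Suc t) = A *\<^sub>v x t"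
  shows "vec_tendsto_zero n x"
proof (cases "n = 0")
  case False
  let ?A = "map_mat complex_of_real A"
  have A': "?A \<in> carrier_mat n n" using A by simp
  have "spectral_radius ?A < 1"
    using spectral_radius_lt_1[OF A'] False s by (auto simp: schur_stable_def)
  then obtain r where r: "max 0 (spectral_radius ?A) < r" "r < 1" using dense[of "max 0 (spectral_radius ?A)" 1] by auto
  then have r0: "r > 0" by auto
  define B where "B = complex_of_real (1 / r) \<cdot>\<^sub>m ?A"
  have B: "B \<in> carrier_mat n n" using A' by (simp add: B_def)
  have "spectral_radius B < 1"
  proof (rule spectral_radius_lt_1[OF B])
    fix w assume "eigenvalue B w"
    then obtain v where v: "v \<in> carrier_vec n" "v \<noteq> 0\<^sub>v n" "B *\<^sub>v v = w \<cdot>\<^sub>v v"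
      using B by (auto simp: eigenvalue_def eigenvector_def)
    have AB: "?A = of_real r \<cdot>\<^sub>m B" using r0 A by (intro eq_matI) (auto simp: B_def)
    have "?A *\<^sub>v v = of_real r \<cdot>\<^sub>v (B *\<^sub>v v)"
      unfolding AB using B v(1)
      by (intro eq_vecI) (auto simp: scalar_prod_def sum_distrib_left mult.assoc)
    also have "\<dots> = (of_real r * w) \<cdot>\<^sub>v v" by (simp add: v smult_smult_assoc)
    finally have "eigenvalue ?A (of_real r * w)" using v A unfolding eigenvalue_def eigenvector_def
      by (intro exI[of _ v]) auto
    then have "cmod (of_real r * w) \<le> spectral_radius ?A"
      by (intro spectral_radius_mem_max(2)[OF A']) (use False in \<open>auto simp: spectrum_def\<close>)
    then have "r * cmod w \<le> spectral_radius ?A" using r0 by (simp add: norm_mult)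
    then have "r * cmod w < r * 1" using r by linarith
    then show "cmod w < 1" using r0 mult_less_cancel_left_pos by blast
  qed (use False in auto)
  from spectral_radius_jnf_norm_bound_less_1_upper_triangular[OF B this]
  obtain c where c: "\<And>k. norm_bound (B ^\<^sub>m k) c" by auto
  define y where "y t = complex_of_real (1 / r ^ t) \<cdot>\<^sub>v map_vec complex_of_real (x t)" for t
  have y: "y t \<in> carrier_vec n" for t using x by (simp add: y_def)
  have "y (Suc t) = B *\<^sub>v y t" for t
  proof (rule eq_vecI)
    fix i assume "i < dim_vec (B *\<^sub>v y t)"
    then have i: "i < n" using B by simp
    show "y (Suc t) $ i = (B *\<^sub>v y t) $ i"
      using i A x[of t] r0 by (auto simp: y_def B_def step scalar_prod_def sum_distrib_left intro!: sum.cong)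
  qed (use y[of "Suc t"] B in auto)
  from orbit_eq_power[where y = y, OF B y this] have yt: "y t = (B ^\<^sub>m t) *\<^sub>v y 0" for t .
  define K where "K = (\<Sum>j<n. c * cmod (y 0 $ j))"
  have bound: "\<bar>x t $ i\<bar> \<le> K * r ^ t" if i: "i < n" for t i
  proof -
    have Bt: "B ^\<^sub>m t \<in> carrier_mat n n" using B pow_carrier_mat by auto
    have "cmod (y t $ i) = cmod (\<Sum>j<n. (B ^\<^sub>m t) $$ (i, j) * y 0 $ j)"
      unfolding yt[of t] using i carrier_matD[OF Bt] carrier_vecD[OF y[of 0]]
      by (simp add: scalar_prod_def atLeast0LessThan)
    also have "\<dots> \<le> (\<Sum>j<n. cmod ((B ^\<^sub>m t) $$ (i, j)) * cmod (y 0 $ j))"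
      by (rule order_trans[OF norm_sum]) (simp add: norm_mult)
    also have "\<dots> \<le> K" unfolding K_def
      using c[of t, unfolded norm_bound_def carrier_matD[OF Bt]] i
      by (intro sum_mono mult_right_mono) auto
    finally have "cmod (y t $ i) \<le> K" .
    moreover have "cmod (y t $ i) = \<bar>x t $ i\<bar> / r ^ t"
      using i x[of t] r0 by (simp add: y_def norm_mult norm_divide norm_power)
    ultimately show ?thesis using r0 by (simp add: field_simps)
  qed
  have K: "(\<lambda>t. K * r ^ t) \<longlonglongrightarrow> 0"
    using tendsto_mult_right_zero[OF LIMSEQ_realpow_zero, of r K] r r0 by simp
  show ?thesis unfolding vec_tendsto_zero_def
    by (auto intro!: tendsto_0_le[OF K, of _ 1] always_eventually
        order_trans[OF bound abs_ge_self])
qed (simp add: vec_tendsto_zero_def)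

text \<open>
  An eigenvector \<open>v\<close> for \<open>w\<close> yields the complex trajectory \<open>w ^ t * v\<close>. Only real trajectories are
  known to converge, but its real and imaginary parts are real trajectories.
\<close>

lemma schur_stable_if_trajectories:
  assumes A: "A \<in> carrier_mat n n"
    and conv: "\<And>x. (\<And>t. x t \<in> carrier_vec n) \<Longrightarrow> (\<And>t. x (Suc t) = A *\<^sub>v x t) \<Longrightarrow> vec_tendsto_zero n x"
  shows "schur_stable A"
  unfolding schur_stable_def
proof (intro allI impI)
  fix w assume "eigenvalue (map_mat complex_of_real A) w"
  then obtain v where v: "v \<in> carrier_vec n" "v \<noteq> 0\<^sub>v n" "map_mat complex_of_real A *\<^sub>v v = w \<cdot>\<^sub>v v"
    using A by (auto simp: eigenvalue_def eigenvector_def)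
  have comp: "(\<Sum>j<n. of_real (A $$ (i, j)) * v $ j) = w * v $ i" if "i < n" for i
    using arg_cong[OF v(3), of "\<lambda>u. u $ i"] A v(1) that by (simp add: scalar_prod_def atLeast0LessThan)
  have comp': "(\<Sum>j<n. of_real (A $$ (i, j)) * (w ^ t * v $ j)) = w ^ Suc t * v $ i" if "i < n" for i t
    using arg_cong[OF comp[OF that], of "\<lambda>s. w ^ t * s"] by (simp add: sum_distrib_left mult_ac)
  have "vec_tendsto_zero n (\<lambda>t. vec n (\<lambda>i. f (w ^ t * v $ i)))"
    if f: "f = Re \<or> f = Im" for f
  proof (rule conv)
    show "vec n (\<lambda>i. f (w ^ Suc t * v $ i)) = A *\<^sub>v vec n (\<lambda>i. f (w ^ t * v $ i))" for t
    proof (rule eq_vecI)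
      fix i assume "i < dim_vec (A *\<^sub>v vec n (\<lambda>i. f (w ^ t * v $ i)))"
      then have i: "i < n" using A by simp
      have "f (w ^ Suc t * v $ i) = (\<Sum>j<n. A $$ (i, j) * f (w ^ t * v $ j))"
        unfolding comp'[OF i, symmetric] using f by (auto simp del: Re_sum Im_sum simp: Re_sum Im_sum)
      then show "vec n (\<lambda>i. f (w ^ Suc t * v $ i)) $ i = (A *\<^sub>v vec n (\<lambda>i. f (w ^ t * v $ i))) $ i"
        using i A by (simp add: scalar_prod_def atLeast0LessThan del: power_Suc)
    qed (use A in auto)
  qed auto
  from this[of Re] this[of Im]
  have lim: "(\<lambda>t. Re (w ^ t * v $ i)) \<longlonglongrightarrow> 0" "(\<lambda>t. Im (w ^ t * v $ i)) \<longlonglongrightarrow> 0" if "i < n" for i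
    using that by (auto simp: vec_tendsto_zero_def)
  obtain i where i: "i < n" "v $ i \<noteq> 0" using v(1,2) by (metis carrier_vecD eq_vecI index_zero_vec)
  have "(\<lambda>t. w ^ t * v $ i) \<longlonglongrightarrow> 0"
    using lim[OF i(1)] by (simp add: tendsto_complex_iff)
  then have "(\<lambda>t. cmod (w ^ t * v $ i)) \<longlonglongrightarrow> 0" by (rule tendsto_norm_zero)
  then have "eventually (\<lambda>t. cmod (w ^ t * v $ i) < cmod (v $ i)) sequentially"
    using i(2) by (intro order_tendstoD) auto
  then obtain t where "cmod (w ^ t * v $ i) < cmod (v $ i)"
    by (auto simp: eventually_sequentially)
  then have "cmod w ^ t < 1" using i(2) by (simp add: norm_mult norm_power)
  then show "cmod w < 1" by (meson not_le one_le_power)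
qed

section \<open>Block matrices and state equations\<close>

text \<open>
  The ring laws for matrices, with side conditions on dimensions instead of carriers. Such conditions
  contain no variables beyond those of the equation, so the simplifier can expand arbitrary matrix
  polynomials with them; the expanded forms are then compared entry by entry, where only commutative
  algebra remains.
\<close>

lemma mat_assoc: "dim_col A = dim_row B \<Longrightarrow> dim_col B = dim_row C \<Longrightarrow> (A :: 'a :: comm_ring_1 mat) * B * C = A * (B * C)"
  by (rule assoc_mult_mat[of _ "dim_row A" "dim_row B" _ "dim_row C" _ "dim_col C"]) auto

lemma mat_distl: "dim_col A = dim_row B \<Longrightarrow> dim_row B = dim_row C \<Longrightarrow> dim_col B = dim_col C
   \<Longrightarrow> (A :: 'a :: comm_ring_1 mat) * (B + C) = A * B + A * C"
  by (rule mult_add_distrib_mat[of _ "dim_row A" "dim_row B" _ "dim_col C"]) auto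

lemma mat_distr: "dim_col B = dim_row A \<Longrightarrow> dim_row B = dim_row C \<Longrightarrow> dim_col B = dim_col C
   \<Longrightarrow> (B + C) * (A :: 'a :: comm_ring_1 mat) = B * A + C * A"
  by (rule add_mult_distrib_mat[of _ "dim_row B" "dim_col B" _ _ "dim_col A"]) auto

lemma mat_mdistl: "dim_col A = dim_row B \<Longrightarrow> dim_row B = dim_row C \<Longrightarrow> dim_col B = dim_col C
   \<Longrightarrow> (A :: 'a :: comm_ring_1 mat) * (B - C) = A * B - A * C"
  by (rule mult_minus_distrib_mat[of _ "dim_row A" "dim_row B" _ "dim_col C"]) auto

lemma mat_mdistr: "dim_col B = dim_row A \<Longrightarrow> dim_row B = dim_row C \<Longrightarrow> dim_col B = dim_col C
   \<Longrightarrow> (B - C) * (A :: 'a :: comm_ring_1 mat) = B * A - C * A"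
  by (rule minus_mult_distrib_mat[of _ "dim_row B" "dim_col B" _ _ "dim_col A"]) auto

lemmas mat_expand = mat_assoc mat_distl mat_distr mat_mdistl mat_mdistr

lemma append_rows_index [simp]:
  "i < dim_row A + dim_row B \<Longrightarrow> j < dim_col A \<Longrightarrow>
    (A @\<^sub>r B) $$ (i, j) = (if i < dim_row A then A $$ (i, j) else B $$ (i - dim_row A, j))"
  "dim_row (A @\<^sub>r B) = dim_row A + dim_row B" "dim_col (A @\<^sub>r B) = dim_col A"
  by (auto simp: append_rows_def)

text \<open>
  Written, like \<^const>\<open>append_rows\<close>, as a block matrix with two empty blocks, so that the product law
  for block matrices applies.
\<close>

definition append_cols :: "'a :: zero mat \<Rightarrow> 'a mat \<Rightarrow> 'a mat" where
  "append_cols A B = four_block_mat A B (0\<^sub>m 0 (dim_col A)) (0\<^sub>m 0 (dim_col B))"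

lemma append_cols_carrier: "A \<in> carrier_mat k a \<Longrightarrow> B \<in> carrier_mat k b \<Longrightarrow> append_cols A B \<in> carrier_mat k (a + b)"
  using four_block_carrier_mat[of A k a "0\<^sub>m 0 b" 0 b] by (auto simp: append_cols_def)

lemma block_mult_append_rows:
  fixes A :: "'a :: comm_ring_1 mat"
  assumes "A \<in> carrier_mat r1 c1" "B \<in> carrier_mat r1 c2" "C \<in> carrier_mat r2 c1" "D \<in> carrier_mat r2 c2"
    "X \<in> carrier_mat c1 l" "Y \<in> carrier_mat c2 l"
  shows "four_block_mat A B C D * (X @\<^sub>r Y) = (A * X + B * Y) @\<^sub>r (C * X + D * Y)"
  unfolding append_rows_def
  by (subst mult_four_block_mat[OF assms(1-5) _ assms(6)]) (use assms in \<open>auto intro!: cong_four_block_mat\<close>)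

lemma append_cols_mult_append_rows:
  fixes A :: "'a :: comm_ring_1 mat"
  assumes "A \<in> carrier_mat r c1" "B \<in> carrier_mat r c2" "X \<in> carrier_mat c1 l" "Y \<in> carrier_mat c2 l"
  shows "append_cols A B * (X @\<^sub>r Y) = A * X + B * Y"
proof -
  have "append_cols A B * (X @\<^sub>r Y) = (A * X + B * Y) @\<^sub>r (0\<^sub>m 0 c1 * X + 0\<^sub>m 0 c2 * Y)"
    unfolding append_cols_def using assms
    by (subst block_mult_append_rows[of _ r c1 _ c2 _ 0 _ _ l]) auto
  also have "\<dots> = A * X + B * Y" by (rule eq_matI) (use assms in auto)
  finally show ?thesis .
qed

lemma append_rows_mult_append_cols:
  fixes A :: "'a :: comm_ring_1 mat"
  assumes "X \<in> carrier_mat r1 l" "Y \<in> carrier_mat r2 l" "A \<in> carrier_mat l c1" "B \<in> carrier_mat l c2"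
  shows "(X @\<^sub>r Y) * append_cols A B = four_block_mat (X * A) (X * B) (Y * A) (Y * B)"
  unfolding append_rows_def append_cols_def using assms
  by (subst mult_four_block_mat[of _ r1 l _ 0 _ r2 _ _ c1 _ c2]) (auto intro!: cong_four_block_mat)

lemma append_rows_split:
  assumes "M \<in> carrier_mat (a + b) l"
  obtains X Y where "X \<in> carrier_mat a l" "Y \<in> carrier_mat b l" "M = X @\<^sub>r Y"
proof
  show "M = mat a l (\<lambda>(i, j). M $$ (i, j)) @\<^sub>r mat b l (\<lambda>(i, j). M $$ (a + i, j))"
    using assms by (intro eq_matI) auto
qed auto

lemma append_rows_eqD:
  assumes "X @\<^sub>r Y = X' @\<^sub>r Y'" "X \<in> carrier_mat a l" "X' \<in> carrier_mat a l" "Y \<in> carrier_mat b l" "Y' \<in> carrier_mat b l"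
  shows "X = X'" "Y = Y'"
proof -
  show "X = X'"
  proof (rule eq_matI)
    fix i j assume "i < dim_row X'" "j < dim_col X'"
    then show "X $$ (i, j) = X' $$ (i, j)"
      using arg_cong[OF assms(1), of "\<lambda>M. M $$ (i, j)"] assms(2-) by auto
  qed (use assms in auto)
  show "Y = Y'"
  proof (rule eq_matI)
    fix i j assume "i < dim_row Y'" "j < dim_col Y'"
    then show "Y $$ (i, j) = Y' $$ (i, j)"
      using arg_cong[OF assms(1), of "\<lambda>M. M $$ (a + i, j)"] assms(2-) by auto
  qed (use assms in auto)
qed

lemma append_rows_add:
  assumes "X \<in> carrier_mat a l" "X' \<in> carrier_mat a l" "Y \<in> carrier_mat b l" "Y' \<in> carrier_mat b l"
  shows "(X @\<^sub>r Y) + (X' @\<^sub>r Y') = (X + X') @\<^sub>r (Y + Y')"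
  using assms by (intro eq_matI) auto

lemma append_rows_smult:
  assumes "X \<in> carrier_mat a l" "Y \<in> carrier_mat b l"
  shows "c \<cdot>\<^sub>m (X @\<^sub>r Y) = (c \<cdot>\<^sub>m X) @\<^sub>r (c \<cdot>\<^sub>m Y)"
  using assms by (intro eq_matI) auto

lemma const_tmat_append_rows:
  assumes "X \<in> carrier_mat a l" "Y \<in> carrier_mat b l"
  shows "const_tmat (X @\<^sub>r Y) = const_tmat X @\<^sub>r const_tmat Y"
  using assms unfolding const_tmat_def by (intro eq_matI) auto

lemma const_tmat_four_block:
  assumes "A \<in> carrier_mat r1 c1" "B \<in> carrier_mat r1 c2" "C \<in> carrier_mat r2 c1" "D \<in> carrier_mat r2 c2"
  shows "const_tmat (four_block_mat A B C D) = four_block_mat (const_tmat A) (const_tmat B) (const_tmat C) (const_tmat D)"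
  unfolding const_tmat_def by (rule map_four_block_mat[OF assms])

lemma const_tmat_append_cols:
  assumes "A \<in> carrier_mat r c1" "B \<in> carrier_mat r c2"
  shows "const_tmat (append_cols A B) = append_cols (const_tmat A) (const_tmat B)"
  using assms by (simp add: append_cols_def const_tmat_four_block[of _ r c1 _ c2 _ 0] const_tmat_zero)

lemma RH_inf_append_rows:
  assumes "X \<in> carrier_mat a l" "Y \<in> carrier_mat b l"
  shows "X @\<^sub>r Y \<in> RH_inf (a + b) l \<longleftrightarrow> X \<in> RH_inf a l \<and> Y \<in> RH_inf b l"
proof
  assume *: "X @\<^sub>r Y \<in> RH_inf (a + b) l"
  { fix i j assume ij: "i < a" "j < l"
    then have "stable_fract ((X @\<^sub>r Y) $$ (i, j))" using * by (auto simp: RH_inf_iff)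
    then have "stable_fract (X $$ (i, j))" using ij assms by auto }
  moreover
  { fix i j assume ij: "i < b" "j < l"
    then have "stable_fract ((X @\<^sub>r Y) $$ (a + i, j))" using * by (auto simp: RH_inf_iff)
    then have "stable_fract (Y $$ (i, j))" using ij assms by auto }
  ultimately show "X \<in> RH_inf a l \<and> Y \<in> RH_inf b l" using assms by (auto simp: RH_inf_iff)
next
  assume "X \<in> RH_inf a l \<and> Y \<in> RH_inf b l"
  then show "X @\<^sub>r Y \<in> RH_inf (a + b) l" using assms by (auto simp: RH_inf_iff)
qed

text \<open>
  All later computations with transfer functions solve a state equation \<open>z s = A s + T\<close> in place of
  manipulating inverses: since \<open>z I - A\<close> is invertible, the state equation has exactly one solution.
\<close>

lemma state_equation_iff:
  assumes A: "A \<in> carrier_mat n n" and s: "s \<in> carrier_mat n l" and T: "T \<in> carrier_mat n l"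
  shows "s = resolvent A * T \<longleftrightarrow> indet_z \<cdot>\<^sub>m s = const_tmat A * s + T"
proof -
  note R = resolvent_inverse[OF A]
  have Z: "zI_minus A * s = indet_z \<cdot>\<^sub>m s - const_tmat A * s"
  proof -
    have "zI_minus A * s = (indet_z \<cdot>\<^sub>m 1\<^sub>m n) * s - const_tmat A * s"
      unfolding zI_minus_def using A s by (subst mat_mdistr) auto
    also have "(indet_z \<cdot>\<^sub>m 1\<^sub>m n) * s = indet_z \<cdot>\<^sub>m s"
      using mult_smult_assoc_mat[OF one_carrier_mat s, of indet_z] s by simp
    finally show ?thesis .
  qed
  have "s = resolvent A * T \<longleftrightarrow> zI_minus A * s = T"
  proof
    assume "s = resolvent A * T"
    then have "zI_minus A * s = zI_minus A * resolvent A * T"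
      using assoc_mult_mat[OF zI_minus_carrier[OF A] R(1) T] by simp
    then show "zI_minus A * s = T" using R T by simp
  next
    assume "zI_minus A * s = T"
    then have "resolvent A * T = resolvent A * zI_minus A * s"
      using assoc_mult_mat[OF R(1) zI_minus_carrier[OF A] s] by simp
    then show "s = resolvent A * T" using R s by simp
  qed
  also have "\<dots> \<longleftrightarrow> indet_z \<cdot>\<^sub>m s = const_tmat A * s + T"
  proof
    assume "zI_minus A * s = T"
    then have "T = indet_z \<cdot>\<^sub>m s - const_tmat A * s" using Z by simp
    then show "indet_z \<cdot>\<^sub>m s = const_tmat A * s + T"
      using A s by (intro eq_matI) (auto simp del: index_mult_mat(1))
  next
    assume e: "indet_z \<cdot>\<^sub>m s = const_tmat A * s + T"
    show "zI_minus A * s = T" unfolding Z e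
      using A s T by (intro eq_matI) (auto simp del: index_mult_mat(1))
  qed
  finally show ?thesis .
qed

lemma transfer_matrix_eq: "transfer_matrix A B C D = const_tmat C * resolvent A * const_tmat B + const_tmat D"
  by (simp add: transfer_matrix_def resolvent_def zI_minus_def)

text \<open>
  The output of a system under the input \<open>w\<close> can be read off from any solution \<open>s\<close> of its state
  equation.
\<close>

lemma transfer_matrix_mult:
  assumes "A \<in> carrier_mat q q" "B \<in> carrier_mat q l" "C \<in> carrier_mat k q" "D \<in> carrier_mat k l"
    and s: "s \<in> carrier_mat q r" and w: "w \<in> carrier_mat l r"
    and eq: "indet_z \<cdot>\<^sub>m s = const_tmat A * s + const_tmat B * w"
  shows "transfer_matrix A B C D * w = const_tmat C * s + const_tmat D * w"
proof -
  have "s = resolvent A * (const_tmat B * w)"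
    using eq state_equation_iff[OF assms(1) s] assms by simp
  then show ?thesis using assms(1-6) resolvent_inverse(1)[OF assms(1)]
    by (auto simp: transfer_matrix_eq mat_expand)
qed

lemma transfer_matrix_carrier:
  assumes "A \<in> carrier_mat q q" "B \<in> carrier_mat q l" "C \<in> carrier_mat k q" "D \<in> carrier_mat k l"
  shows "transfer_matrix A B C D \<in> carrier_mat k l"
  using assms unfolding transfer_matrix_eq by (intro carrier_matI) auto

lemma transfer_matrixI:
  assumes "A \<in> carrier_mat q q" "B \<in> carrier_mat q l" "C \<in> carrier_mat k q" "D \<in> carrier_mat k l"
    and "s \<in> carrier_mat q l"
    and "indet_z \<cdot>\<^sub>m s = const_tmat A * s + const_tmat B"
  shows "transfer_matrix A B C D = const_tmat C * s + const_tmat D"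
proof -
  have "transfer_matrix A B C D * 1\<^sub>m l = const_tmat C * s + const_tmat D * 1\<^sub>m l"
    by (rule transfer_matrix_mult) (use assms in auto)
  then show ?thesis using assms transfer_matrix_carrier[OF assms(1-4)]
    by (simp add: right_mult_one_mat[of _ k l])
qed

lemma block_state_equation:
  assumes A: "A \<in> carrier_mat a a" and B: "B \<in> carrier_mat a b" and C: "C \<in> carrier_mat b a" and D: "D \<in> carrier_mat b b"
    and X: "X \<in> carrier_mat a l" and Y: "Y \<in> carrier_mat b l" and S: "S \<in> carrier_mat a l" and T: "T \<in> carrier_mat b l"
  shows "indet_z \<cdot>\<^sub>m (X @\<^sub>r Y) = const_tmat (four_block_mat A B C D) * (X @\<^sub>r Y) + (S @\<^sub>r T) \<longleftrightarrow>
    indet_z \<cdot>\<^sub>m X = const_tmat A * X + const_tmat B * Y + S \<and>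
    indet_z \<cdot>\<^sub>m Y = const_tmat C * X + const_tmat D * Y + T"
    (is "?z = ?r \<longleftrightarrow> ?X = ?SX \<and> ?Y = ?SY")
proof -
  have r: "?r = ?SX @\<^sub>r ?SY"
    unfolding const_tmat_four_block[OF A B C D]
    using assms by (subst block_mult_append_rows[of _ a a _ b _ b _ _ l]) (auto intro!: append_rows_add[of _ a l _ _ b])
  have z: "?z = ?X @\<^sub>r ?Y" by (rule append_rows_smult[OF X Y])
  have car: "?X \<in> carrier_mat a l" "?SX \<in> carrier_mat a l" "?Y \<in> carrier_mat b l" "?SY \<in> carrier_mat b l"
    using assms by auto
  show ?thesis unfolding r z
  proof
    assume "?X @\<^sub>r ?Y = ?SX @\<^sub>r ?SY"
    from append_rows_eqD[OF this car] show "?X = ?SX \<and> ?Y = ?SY" by (rule conjI)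
  qed simp
qed

section \<open>Stable state-space realizations of stable transfer matrices\<close>

definition schur_realizable :: "nat \<Rightarrow> nat \<Rightarrow> tmat \<Rightarrow> bool" where
  "schur_realizable k l Q \<longleftrightarrow> (\<exists>q A B C D. A \<in> carrier_mat q q \<and> B \<in> carrier_mat q l \<and>
     C \<in> carrier_mat k q \<and> D \<in> carrier_mat k l \<and> schur_stable A \<and> Q = transfer_matrix A B C D)"

lemma schur_realizableI:
  assumes "A \<in> carrier_mat q q" "B \<in> carrier_mat q l" "C \<in> carrier_mat k q" "D \<in> carrier_mat k l"
    and "schur_stable A"
  shows "schur_realizable k l (transfer_matrix A B C D)"
  unfolding schur_realizable_def using assms by blast

text \<open>
  Parallel connection: the two systems share the input, and their outputs are added.
\<close>

lemma schur_realizable_add: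
  assumes "schur_realizable k l P" "schur_realizable k l Q"
  shows "schur_realizable k l (P + Q)"
proof -
  obtain q A B C D where 1: "A \<in> carrier_mat q q" "B \<in> carrier_mat q l"
     "C \<in> carrier_mat k q" "D \<in> carrier_mat k l" "schur_stable A" "P = transfer_matrix A B C D"
    using assms(1) by (auto simp: schur_realizable_def)
  obtain q' A' B' C' D' where 2: "A' \<in> carrier_mat q' q'" "B' \<in> carrier_mat q' l"
     "C' \<in> carrier_mat k q'" "D' \<in> carrier_mat k l" "schur_stable A'" "Q = transfer_matrix A' B' C' D'"
    using assms(2) by (auto simp: schur_realizable_def)
  note R = resolvent_inverse(1)[OF 1(1)] resolvent_inverse(1)[OF 2(1)]
  define s s' where "s = resolvent A * const_tmat B" and "s' = resolvent A' * const_tmat B'"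
  have s: "s \<in> carrier_mat q l" "s' \<in> carrier_mat q' l" using R 1 2 by (auto simp: s_def s'_def)
  have e: "indet_z \<cdot>\<^sub>m s = const_tmat A * s + const_tmat B" "indet_z \<cdot>\<^sub>m s' = const_tmat A' * s' + const_tmat B'"
    using state_equation_iff[OF 1(1) s(1), of "const_tmat B"]
      state_equation_iff[OF 2(1) s(2), of "const_tmat B'"] 1 2 by (auto simp: s_def s'_def)
  let ?A = "four_block_mat A (0\<^sub>m q q') (0\<^sub>m q' q) A'" and ?B = "B @\<^sub>r B'" and ?C = "append_cols C C'"
  have "indet_z \<cdot>\<^sub>m (s @\<^sub>r s') = const_tmat ?A * (s @\<^sub>r s') + const_tmat ?B"
    unfolding const_tmat_append_rows[OF 1(2) 2(2)]
    using 1 2 s e by (subst block_state_equation[of _ q _ q' _ _ _ l]) (auto simp: const_tmat_zero)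
  then have "transfer_matrix ?A ?B ?C (D + D') = const_tmat ?C * (s @\<^sub>r s') + const_tmat (D + D')"
    using 1(1-4) 2(1-4) s append_cols_carrier[OF 1(3) 2(3)]
    by (intro transfer_matrixI[where q = "q + q'" and l = l and k = k]) simp_all
  also have "const_tmat ?C * (s @\<^sub>r s') = const_tmat C * s + const_tmat C' * s'"
    using 1 2 s by (simp add: const_tmat_append_cols[of _ k q _ q'] append_cols_mult_append_rows[of _ k q _ q' _ l])
  also have "const_tmat (D + D') = const_tmat D + const_tmat D'" by (rule const_tmat_add) (use 1 2 in auto)
  also have "const_tmat C * s + const_tmat C' * s' + (const_tmat D + const_tmat D') =
      (const_tmat C * s + const_tmat D) + (const_tmat C' * s' + const_tmat D')"
    using 1 2 s by (intro eq_matI) (auto simp: algebra_simps simp del: index_mult_mat(1))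
  also have "\<dots> = P + Q"
    using transfer_matrixI[OF 1(1-4) s(1) e(1)] transfer_matrixI[OF 2(1-4) s(2) e(2)] 1 2 by simp
  finally have "P + Q = transfer_matrix ?A ?B ?C (D + D')" ..
  moreover have "schur_stable ?A" by (rule schur_stable_block(1)) (use 1 2 in auto)
  ultimately show ?thesis
    using 1(1-4) 2(1-4) append_cols_carrier[OF 1(3) 2(3)]
    by (simp add: schur_realizableI[where q = "q + q'"])
qed

lemma schur_realizable_sandwich:
  assumes "schur_realizable a b Q" and E: "E \<in> carrier_mat k a" and F: "F \<in> carrier_mat b l"
  shows "schur_realizable k l (const_tmat E * Q * const_tmat F)"
proof -
  obtain q A B C D where 1: "A \<in> carrier_mat q q" "B \<in> carrier_mat q b"
     "C \<in> carrier_mat a q" "D \<in> carrier_mat a b" "schur_stable A" "Q = transfer_matrix A B C D"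
    using assms(1) by (auto simp: schur_realizable_def)
  have c: "const_tmat (E * C) = const_tmat E * const_tmat C" "const_tmat (B * F) = const_tmat B * const_tmat F"
    "const_tmat (E * D * F) = const_tmat E * const_tmat D * const_tmat F"
    using 1 E F by (simp_all add: const_tmat_mult[OF E 1(3)] const_tmat_mult[OF 1(2) F]
        const_tmat_mult[OF E mult_carrier_mat[OF 1(4) F]] const_tmat_mult[OF 1(4) F])
  have "const_tmat E * Q * const_tmat F = transfer_matrix A (B * F) (E * C) (E * D * F)"
    unfolding transfer_matrix_eq c 1(6) using 1(1-4) E F resolvent_inverse(1)[OF 1(1)]
    by (simp add: mat_expand)
  then show ?thesis using 1(1-5) E F by (simp add: schur_realizableI[where q = q])
qed

lemma schur_realizable_zero: "schur_realizable k l (0\<^sub>m k l)"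
proof -
  have e: "schur_stable (0\<^sub>m 0 0)"
    by (auto simp: schur_stable_def eigenvalue_def eigenvector_def)
  have "transfer_matrix (0\<^sub>m 0 0) (0\<^sub>m 0 l) (0\<^sub>m k 0) (0\<^sub>m k l) = 0\<^sub>m k l"
    by (subst transfer_matrixI[of _ 0 _ l _ k _ "0\<^sub>m 0 l"]) (auto simp: const_tmat_zero)
  then show ?thesis
    using schur_realizableI[OF zero_carrier_mat zero_carrier_mat zero_carrier_mat zero_carrier_mat e, of k l] by simp
qed

text \<open>
  For the row convention chosen here, the vector \<open>(1, z, z^2, \<dots>)\<close> is an eigenvector for every
  root \<open>z\<close> of \<open>b\<close>; the coefficients of \<open>b\<close> enter only the last row.
\<close>

definition companion_mat :: "real poly \<Rightarrow> real mat" where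
  "companion_mat b = mat (degree b) (degree b) (\<lambda>(i, j).
     if Suc i < degree b then (if j = Suc i then 1 else 0) else - coeff b j / lead_coeff b)"

lemma companion_mat_carrier: "companion_mat b \<in> carrier_mat (degree b) (degree b)"
  by (simp add: companion_mat_def)

lemma companion_mult:
  fixes g :: "real \<Rightarrow> 'a :: comm_ring_1"
  assumes i: "i < degree b" and g: "g 0 = 0" "g 1 = 1"
  shows "(\<Sum>j<degree b. g (companion_mat b $$ (i, j)) * x j) =
    (if Suc i < degree b then x (Suc i) else (\<Sum>j<degree b. g (- coeff b j / lead_coeff b) * x j))"
proof (cases "Suc i < degree b")
  case True
  then have "(\<Sum>j<degree b. g (companion_mat b $$ (i, j)) * x j) = (\<Sum>j<degree b. if j = Suc i then x j else 0)"
    using i g by (intro sum.cong) (auto simp: companion_mat_def)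
  then show ?thesis using True by simp
next
  case False
  then show ?thesis using i by (auto simp: companion_mat_def intro!: sum.cong)
qed

lemma poly_eq_sum_lessThan:
  fixes b :: "'a :: comm_ring_1 poly"
  shows "poly b x = (\<Sum>j<degree b. coeff b j * x ^ j) + lead_coeff b * x ^ degree b"
  by (simp add: poly_altdef lessThan_Suc_atMost[symmetric])

text \<open>
  All rows but the last force an eigenvector for \<open>w\<close> to be a multiple of \<open>(1, w, w^2, \<dots>)\<close>, and then the
  last row says that \<open>w\<close> is a root of \<open>b\<close>.
\<close>

lemma companion_mat_schur:
  assumes b: "schur_poly b"
  shows "schur_stable (companion_mat b)"
  unfolding schur_stable_def
proof (intro allI impI)
  let ?N = "degree b"
  fix w assume "eigenvalue (map_mat complex_of_real (companion_mat b)) w"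
  then obtain v where v: "v \<in> carrier_vec ?N" "v \<noteq> 0\<^sub>v ?N"
    "map_mat complex_of_real (companion_mat b) *\<^sub>v v = w \<cdot>\<^sub>v v"
    using companion_mat_carrier[of b] by (auto simp: eigenvalue_def eigenvector_def)
  have rows: "(\<Sum>j<?N. of_real (companion_mat b $$ (i, j)) * v $ j) = w * v $ i" if "i < ?N" for i
    using arg_cong[OF v(3), of "\<lambda>u. u $ i"] carrier_matD[OF companion_mat_carrier[of b]] v(1) that
    by (simp add: scalar_prod_def atLeast0LessThan)
  have step: "v $ Suc i = w * v $ i" if "Suc i < ?N" for i
    using rows[of i] companion_mult[of i b complex_of_real "\<lambda>j. v $ j"] that by simp
  have pw: "v $ i = w ^ i * v $ 0" if "i < ?N" for i
    using that by (induction i) (auto simp: step)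
  have N: "?N > 0"
  proof (rule ccontr)
    assume "\<not> ?N > 0"
    then have "v = 0\<^sub>v ?N" using v(1) by (intro eq_vecI) auto
    then show False using v(2) by simp
  qed
  have v0: "v $ 0 \<noteq> 0"
  proof
    assume "v $ 0 = 0"
    then have "v = 0\<^sub>v ?N" using v(1) pw by (intro eq_vecI) auto
    then show False using v(2) by simp
  qed
  have lc: "lead_coeff b \<noteq> 0" using b by (auto simp: schur_poly_def)
  have "(\<Sum>j<?N. of_real (- coeff b j / lead_coeff b) * v $ j) = w * v $ (?N - 1)"
    using rows[of "?N - 1"] companion_mult[of "?N - 1" b complex_of_real "\<lambda>j. v $ j"] N by simp
  then have "(\<Sum>j<?N. of_real (- coeff b j / lead_coeff b) * (w ^ j * v $ 0)) = w * (w ^ (?N - 1) * v $ 0)"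
    using pw[of "?N - 1"] N by (simp add: pw[symmetric] del: of_real_minus of_real_divide)
  also have "\<dots> = w ^ ?N * v $ 0" using N by (simp flip: power_Suc mult.assoc)
  finally have "of_real (lead_coeff b) * (\<Sum>j<?N. of_real (- coeff b j / lead_coeff b) * (w ^ j * v $ 0)) =
     of_real (lead_coeff b) * w ^ ?N * v $ 0" by simp
  then have "(\<Sum>j<?N. - of_real (coeff b j) * w ^ j * v $ 0) = of_real (lead_coeff b) * w ^ ?N * v $ 0"
    using lc by (simp add: sum_distrib_left mult.assoc)
  moreover have "(\<Sum>j<?N. - of_real (coeff b j) * w ^ j * v $ 0) = - (\<Sum>j<?N. of_real (coeff b j) * w ^ j) * v $ 0"
    by (simp add: sum_distrib_right sum_negf)
  ultimately have "((\<Sum>j<?N. of_real (coeff b j) * w ^ j) + of_real (lead_coeff b) * w ^ ?N) * v $ 0 = 0"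
    by (simp add: distrib_right)
  moreover have "poly (map_poly complex_of_real b) w = (\<Sum>j<?N. of_real (coeff b j) * w ^ j) + of_real (lead_coeff b) * w ^ ?N"
    by (subst poly_eq_sum_lessThan) (simp add: coeff_map_poly)
  ultimately show "cmod w < 1" using v0 b by (auto simp: schur_poly_def)
qed

lemma to_fract_eq_sum:
  "to_fract a = (\<Sum>j\<le>N. to_fract [:coeff a j:] * indet_z ^ j)" if "degree a \<le> N" for a :: "real poly"
proof -
  have "a = (\<Sum>j\<le>N. monom (coeff a j) j)"
    using that poly_as_sum_of_monoms'[of a N] by simp
  then have "to_fract a = (\<Sum>j\<le>N. to_fract (monom (coeff a j) j))"
    by (metis to_fract_sum)
  moreover have "to_fract (monom c j) = to_fract [:c:] * indet_z ^ j" for c :: real and j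
  proof (induction j)
    case (Suc j)
    have "monom c (Suc j) = [:0, 1:] * monom c j" by (simp add: monom_Suc)
    then have "to_fract (monom c (Suc j)) = indet_z * to_fract (monom c j)" by (simp only: to_fract_mult)
    then show ?case using Suc by (simp add: mult_ac)
  qed (simp add: monom_0)
  ultimately show ?thesis by simp
qed

text \<open>
  For \<open>f = a / b\<close> with \<open>N = degree b\<close> the state is \<open>(1 / b, z / b, \<dots>, z^(N-1) / b)\<close>. Multiplication by \<open>z\<close>
  shifts it, and solving \<open>b / b = 1\<close> for its leading term expresses \<open>z^N / b\<close> through the state and the
  constant 1.
\<close>

lemma scalar_schur_realizable:
  assumes f: "stable_fract f"
  shows "schur_realizable 1 1 (mat 1 1 (\<lambda>_. f))"
proof -
  obtain a b where ab: "f = to_fract a / to_fract b" "degree a \<le> degree b" and b: "schur_poly b"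
    using f by (auto simp: stable_fract_iff)
  let ?N = "degree b"
  define k where "k c = to_fract [:c :: real:]" for c
  have k: "k (c * d) = k c * k d" "k (c - d) = k c - k d" "k (- c) = - k c" "k 0 = 0" "k 1 = 1" for c d
    by (simp_all add: k_def to_fract_const_mult to_fract_const_diff to_fract_const_uminus flip: one_pCons)
  have b0: "to_fract b \<noteq> 0" and lc: "lead_coeff b \<noteq> 0" using b by (auto simp: schur_poly_def)
  define x where "x j = indet_z ^ j / to_fract b" for j
  have sumx: "to_fract c / to_fract b = (\<Sum>j<?N. k (coeff c j) * x j) + k (coeff c ?N) * x ?N"
    if "degree c \<le> ?N" for c
    unfolding to_fract_eq_sum[OF that] sum_divide_distrib
    by (simp add: k_def x_def lessThan_Suc_atMost[symmetric])
  have one: "(\<Sum>j<?N. k (coeff b j) * x j) + k (lead_coeff b) * x ?N = 1"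
    using sumx[of b] b0 by simp
  have lci: "k (1 / lead_coeff b) * k (lead_coeff b) = 1" using lc by (simp flip: k)
  have xN: "x ?N = (\<Sum>j<?N. k (- coeff b j / lead_coeff b) * x j) + k (1 / lead_coeff b)"
  proof -
    have "k (1 / lead_coeff b) * ((\<Sum>j<?N. k (coeff b j) * x j) + k (lead_coeff b) * x ?N) = k (1 / lead_coeff b)"
      by (simp only: one mult_1_right)
    moreover have "k (1 / lead_coeff b) * (\<Sum>j<?N. k (coeff b j) * x j) = (\<Sum>j<?N. k (coeff b j / lead_coeff b) * x j)"
      by (simp add: sum_distrib_left mult.assoc[symmetric] k(1)[symmetric])
    moreover have "k (1 / lead_coeff b) * (k (lead_coeff b) * x ?N) = x ?N"
      using lci by (simp add: mult.assoc[symmetric])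
    ultimately have "(\<Sum>j<?N. k (coeff b j / lead_coeff b) * x j) + x ?N = k (1 / lead_coeff b)"
      by (simp add: distrib_left)
    then show ?thesis by (simp add: k sum_negf algebra_simps)
  qed
  define B where "B = mat ?N 1 (\<lambda>(i, _). if Suc i < ?N then 0 else 1 / lead_coeff b)"
  define C where "C = mat 1 ?N (\<lambda>(_, j). coeff a j - coeff a ?N * (coeff b j / lead_coeff b))"
  \<comment> \<open>the numerator minus the multiple of \<open>b\<close> that cancels its coefficient of degree \<open>N\<close> gives \<open>C\<close>; that multiple gives \<open>D\<close>\<close>
  define D where "D = mat 1 1 (\<lambda>_. coeff a ?N / lead_coeff b)"
  define s where "s = mat ?N 1 (\<lambda>(i, _). x i)"
  note car = companion_mat_carrier[of b]
  have "indet_z \<cdot>\<^sub>m s = const_tmat (companion_mat b) * s + const_tmat B"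
  proof (rule eq_matI)
    fix i j assume "i < dim_row (const_tmat (companion_mat b) * s + const_tmat B)"
      "j < dim_col (const_tmat (companion_mat b) * s + const_tmat B)"
    then have i: "i < ?N" and j: "j = 0" by (auto simp: B_def)
    have "(const_tmat (companion_mat b) * s) $$ (i, 0) = (\<Sum>j<?N. k (companion_mat b $$ (i, j)) * x j)"
      using i carrier_matD[OF car]
      by (simp add: const_tmat_def s_def scalar_prod_def k_def atLeast0LessThan)
    also have "\<dots> = (if Suc i < ?N then x (Suc i) else (\<Sum>j<?N. k (- coeff b j / lead_coeff b) * x j))"
      by (rule companion_mult[OF i]) (rule k)+
    finally have r: "(const_tmat (companion_mat b) * s) $$ (i, 0) = \<dots>" .
    have "indet_z * x i = x (Suc i)" by (simp add: x_def)
    moreover have "\<not> Suc i < ?N \<Longrightarrow> x (Suc i) = x ?N" using i by (metis Suc_lessI)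
    ultimately show "(indet_z \<cdot>\<^sub>m s) $$ (i, j) = (const_tmat (companion_mat b) * s + const_tmat B) $$ (i, j)"
      using i j r xN by (auto simp: s_def B_def const_tmat_def k_def[symmetric] k simp del: index_mult_mat(1))
  qed (use car in \<open>auto simp: s_def B_def\<close>)
  then have "transfer_matrix (companion_mat b) B C D = const_tmat C * s + const_tmat D"
    by (intro transfer_matrixI) (auto simp: car B_def C_def D_def s_def)
  also have "\<dots> = mat 1 1 (\<lambda>_. f)"
  proof (rule eq_matI)
    have "f = (\<Sum>j<?N. k (coeff a j) * x j) + k (coeff a ?N) * x ?N" using ab sumx by simp
    also have "\<dots> = (\<Sum>j<?N. k (coeff a j - coeff a ?N * (coeff b j / lead_coeff b)) * x j) + k (coeff a ?N / lead_coeff b)"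
    proof -
      have "k (coeff a ?N) * x ?N = (\<Sum>j<?N. k (- (coeff a ?N * (coeff b j / lead_coeff b))) * x j) + k (coeff a ?N / lead_coeff b)"
        unfolding xN distrib_left sum_distrib_left by (simp flip: k mult.assoc)
      then show ?thesis by (simp add: k sum_subtractf algebra_simps sum_negf)
    qed
    finally have f': "f = \<dots>" .
    fix i j assume "i < dim_row (mat 1 1 (\<lambda>_. f))" "j < dim_col (mat 1 1 (\<lambda>_. f))"
    then show "(const_tmat C * s + const_tmat D) $$ (i, j) = mat 1 1 (\<lambda>_. f) $$ (i, j)"
      by (auto simp: const_tmat_def C_def s_def D_def scalar_prod_def f' k_def[symmetric] atLeast0LessThan)
  qed (auto simp: C_def D_def s_def)
  finally have "mat 1 1 (\<lambda>_. f) = transfer_matrix (companion_mat b) B C D" ..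
  then show ?thesis
    by (simp only:) (rule schur_realizableI[OF car _ _ _ companion_mat_schur[OF b]];
      simp add: B_def C_def D_def)
qed

text \<open>
  A transfer matrix is the sum of its entries placed by unit vectors, so the scalar case and parallel
  connection suffice.
\<close>

lemma RH_inf_schur_realizable:
  assumes Q: "Q \<in> RH_inf k l"
  shows "schur_realizable k l Q"
proof -
  let ?P = "\<lambda>S. mat k l (\<lambda>(i, j). if (i, j) \<in> S then Q $$ (i, j) else 0)"
  have "schur_realizable k l (?P S)" if "finite S" "S \<subseteq> {..<k} \<times> {..<l}" for S
    using that
  proof (induction S rule: finite_induct)
    case empty
    have "?P {} = 0\<^sub>m k l" by (rule eq_matI) auto
    then show ?case using schur_realizable_zero by metis
  next
    case (insert e S)
    obtain i j where e: "e = (i, j)" "i < k" "j < l" using insert by auto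
    define E F where "E = mat k 1 (\<lambda>(r, _). if r = i then 1 else (0 :: real))" and "F = mat 1 l (\<lambda>(_, c). if c = j then 1 else (0 :: real))"
    let ?q = "mat 1 1 (\<lambda>_. Q $$ (i, j))"
    have st: "stable_fract (Q $$ (i, j))" using Q e by (auto simp: RH_inf_iff)
    have "schur_realizable k l (const_tmat E * ?q * const_tmat F)"
      by (rule schur_realizable_sandwich[OF scalar_schur_realizable[OF st]]) (auto simp: E_def F_def)
    moreover have "schur_realizable k l (?P S)" by (rule insert.IH) (use insert.prems in auto)
    ultimately have "schur_realizable k l (?P S + const_tmat E * ?q * const_tmat F)"
      by (intro schur_realizable_add)
    also have "?P S + const_tmat E * ?q * const_tmat F = ?P (insert e S)"
      using insert(2) e
      by (intro eq_matI) (auto simp: E_def F_def const_tmat_def scalar_prod_def simp flip: one_pCons)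
    finally show ?case .
  qed
  from this[of "{..<k} \<times> {..<l}"] have "schur_realizable k l (?P ({..<k} \<times> {..<l}))" by simp
  also have "?P ({..<k} \<times> {..<l}) = Q" using RH_inf_carrier[OF Q] by (intro eq_matI) auto
  finally show ?thesis .
qed

section \<open>From an internally stable loop to a coprime factor\<close>

lemma vec_assoc: "dim_col A = dim_row B \<Longrightarrow> dim_col B = dim_vec v \<Longrightarrow> ((A :: 'a :: comm_ring_1 mat) * B) *\<^sub>v v = A *\<^sub>v (B *\<^sub>v v)"
  using assoc_mult_mat_vec[of A "dim_row A" "dim_row B" B "dim_vec v" v] carrier_vec_dim_vec[of v]
  by (metis carrier_mat_triv)

lemma vec_distl: "dim_col A = dim_vec v \<Longrightarrow> dim_vec v = dim_vec w \<Longrightarrow>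
    (A :: 'a :: comm_ring_1 mat) *\<^sub>v (v + w) = A *\<^sub>v v + A *\<^sub>v w"
  using mult_add_distrib_mat_vec[of A "dim_row A" "dim_vec v" v w]
  by (metis carrier_mat_triv carrier_vec_dim_vec)

lemma vec_distr: "dim_col A = dim_vec v \<Longrightarrow> dim_col A = dim_col B \<Longrightarrow> dim_row A = dim_row B \<Longrightarrow>
    ((A :: 'a :: comm_ring_1 mat) + B) *\<^sub>v v = A *\<^sub>v v + B *\<^sub>v v"
  using add_mult_distrib_mat_vec[of A "dim_row A" "dim_vec v" B v]
  by (metis carrier_mat_triv carrier_vec_dim_vec)

lemma vec_mdistl: "dim_col A = dim_vec v \<Longrightarrow> dim_vec v = dim_vec w \<Longrightarrow>
    (A :: 'a :: comm_ring_1 mat) *\<^sub>v (v - w) = A *\<^sub>v v - A *\<^sub>v w"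
  using mult_minus_distrib_mat_vec[of A "dim_row A" "dim_vec v" v w]
  by (metis carrier_mat_triv carrier_vec_dim_vec)

lemma vec_mdistr: "dim_col A = dim_vec v \<Longrightarrow> dim_col A = dim_col B \<Longrightarrow> dim_row A = dim_row B \<Longrightarrow>
    ((A :: 'a :: comm_ring_1 mat) - B) *\<^sub>v v = A *\<^sub>v v - B *\<^sub>v v"
  using minus_mult_distrib_mat_vec[of A "dim_row A" "dim_vec v" B v]
  by (metis carrier_mat_triv carrier_vec_dim_vec)

lemmas vec_expand = vec_assoc vec_distl vec_distr vec_mdistl vec_mdistr

text \<open>
  Since the plant is strictly proper, \<open>u\<close> and \<open>y\<close> can be eliminated from the loop equations, and every
  trajectory of the resulting block matrix comes from a trajectory of the loop.
\<close>

lemma closed_loop_schur: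
  assumes A: "A \<in> carrier_mat n n" and B: "B \<in> carrier_mat n m" and C: "C \<in> carrier_mat p n"
    and AK: "A\<^sub>K \<in> carrier_mat q q" and BK: "B\<^sub>K \<in> carrier_mat q p"
    and CK: "C\<^sub>K \<in> carrier_mat m q" and DK: "D\<^sub>K \<in> carrier_mat m p"
    and stab: "internally_stable_loop n m p q A B C A\<^sub>K B\<^sub>K C\<^sub>K D\<^sub>K"
  shows "schur_stable (four_block_mat (A + B * D\<^sub>K * C) (B * C\<^sub>K) (B\<^sub>K * C) A\<^sub>K)"
proof (rule schur_stable_if_trajectories[of _ "n + q"])
  let ?A = "four_block_mat (A + B * D\<^sub>K * C) (B * C\<^sub>K) (B\<^sub>K * C) A\<^sub>K"
  show "?A \<in> carrier_mat (n + q) (n + q)" using assms by simp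
  fix z assume z: "\<And>t. z t \<in> carrier_vec (n + q)" and step: "\<And>t. z (Suc t) = ?A *\<^sub>v z t"
  define x \<xi> where "x t = vec_first (z t) n" and "\<xi> t = vec_last (z t) q" for t
  have zt: "z t = x t @\<^sub>v \<xi> t" for t using z[of t] by (simp add: x_def \<xi>_def)
  have car: "x t \<in> carrier_vec n" "\<xi> t \<in> carrier_vec q" for t by (simp_all add: x_def \<xi>_def)
  define y u where "y t = C *\<^sub>v x t" and "u t = C\<^sub>K *\<^sub>v \<xi> t + D\<^sub>K *\<^sub>v y t" for t
  have yu: "y t \<in> carrier_vec p" "u t \<in> carrier_vec m" for t
    using car C CK DK by (auto simp: y_def u_def)
  have "x (Suc t) @\<^sub>v \<xi> (Suc t) =
      ((A + B * D\<^sub>K * C) *\<^sub>v x t + (B * C\<^sub>K) *\<^sub>v \<xi> t) @\<^sub>v ((B\<^sub>K * C) *\<^sub>v x t + A\<^sub>K *\<^sub>v \<xi> t)" for t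
    unfolding zt[symmetric] step unfolding zt
    by (rule four_block_mat_mult_vec) (use assms car in auto)
  then have "x (Suc t) = (A + B * D\<^sub>K * C) *\<^sub>v x t + (B * C\<^sub>K) *\<^sub>v \<xi> t \<and> \<xi> (Suc t) = (B\<^sub>K * C) *\<^sub>v x t + A\<^sub>K *\<^sub>v \<xi> t" for t
    by (subst (asm) append_vec_eq[of _ n]) (use car A B in \<open>auto intro!: carrier_vecI\<close>)
  then have st: "x (Suc t) = (A + B * D\<^sub>K * C) *\<^sub>v x t + (B * C\<^sub>K) *\<^sub>v \<xi> t"
    "\<xi> (Suc t) = (B\<^sub>K * C) *\<^sub>v x t + A\<^sub>K *\<^sub>v \<xi> t" for t by blast+
  have "x (Suc t) = A *\<^sub>v x t + B *\<^sub>v u t + 0\<^sub>v n" for t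
    unfolding st u_def y_def using car[of t] A B C CK DK
    by (intro eq_vecI) (simp_all add: vec_expand del: index_mult_mat_vec)
  then have plant: "plant_eqs n m p A B C (\<lambda>_. 0\<^sub>v n) (\<lambda>_. 0\<^sub>v p) x u y"
    unfolding plant_eqs_def using car yu C by (auto simp: y_def)
  have "\<xi> (Suc t) = A\<^sub>K *\<^sub>v \<xi> t + B\<^sub>K *\<^sub>v y t" for t
    unfolding st y_def using car[of t] C AK BK
    by (intro eq_vecI) (simp_all add: vec_expand del: index_mult_mat_vec)
  then have "controller_eqs q m p A\<^sub>K B\<^sub>K C\<^sub>K D\<^sub>K (\<lambda>_. 0\<^sub>v m) \<xi> u y"
    unfolding controller_eqs_def using car yu CK DK by (auto simp: u_def)
  with plant stab have lim: "vec_tendsto_zero n x" "vec_tendsto_zero q \<xi>"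
    unfolding internally_stable_loop_def by blast+
  show "vec_tendsto_zero (n + q) z" unfolding vec_tendsto_zero_def
  proof (intro allI impI)
    fix i assume i: "i < n + q"
    have "z t $ i = (if i < n then x t $ i else \<xi> t $ (i - n))" for t
      unfolding zt using i carrier_vecD[OF car(1)[of t]] carrier_vecD[OF car(2)[of t]] by simp
    moreover have "(\<lambda>t. if i < n then x t $ i else \<xi> t $ (i - n)) \<longlonglongrightarrow> 0"
      using lim i by (cases "i < n") (auto simp: vec_tendsto_zero_def)
    ultimately show "(\<lambda>t. z t $ i) \<longlonglongrightarrow> 0" by simp
  qed
qed

text \<open>
  It suffices to solve \<open>Y = K X\<close> and \<open>X = G (Y - V) + U\<close>, because \<open>M G = N\<close> and \<open>U - G V\<close> is a
  right inverse of \<open>M\<close>. These are the equations of the closed loop in which \<open>- V\<close> is injected at the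
  plant input and \<open>U\<close> at the plant output. Injecting the stable signals \<open>U\<close> and \<open>V\<close> into a loop with
  a stable state matrix leaves all signals stable.
\<close>

lemma stabilizing_controller_factor:
  assumes A: "A \<in> carrier_mat n n" and B: "B \<in> carrier_mat n m" and C: "C \<in> carrier_mat p n"
    and AK: "A\<^sub>K \<in> carrier_mat q q" and BK: "B\<^sub>K \<in> carrier_mat q p"
    and CK: "C\<^sub>K \<in> carrier_mat m q" and DK: "D\<^sub>K \<in> carrier_mat m p"
    and schur: "schur_stable (four_block_mat (A + B * D\<^sub>K * C) (B * C\<^sub>K) (B\<^sub>K * C) A\<^sub>K)"
    and U: "U \<in> RH_inf p p" and V: "V \<in> RH_inf m p" and N: "N \<in> carrier_mat p m" and M: "M \<in> carrier_mat p p"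
    and bezout: "M * U - N * V = 1\<^sub>m p" and MG: "M * transfer_matrix A B C (0\<^sub>m p m) = N"
  shows "\<exists>X Y. X \<in> RH_inf p p \<and> Y \<in> RH_inf m p \<and> M * X - N * Y = 1\<^sub>m p \<and>
    Y = transfer_matrix A\<^sub>K B\<^sub>K C\<^sub>K D\<^sub>K * X"
proof -
  let ?A = "four_block_mat (A + B * D\<^sub>K * C) (B * C\<^sub>K) (B\<^sub>K * C) A\<^sub>K"
  let ?c = const_tmat
  note cU = RH_inf_carrier[OF U] and cV = RH_inf_carrier[OF V]
  \<comment> \<open>the effect of the injected signals on the plant state and on the controller state, once \<open>u\<close> and \<open>y\<close> are eliminated\<close>
  define S T where "S = ?c B * (?c D\<^sub>K * U - V)" and "T = ?c B\<^sub>K * U"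
  have ST: "S \<in> RH_inf n p" "T \<in> RH_inf q p" unfolding S_def T_def
    using U V B BK DK by (auto intro!: RH_inf_mult[of _ n m] RH_inf_mult[of _ m p] RH_inf_mult[of _ q p] RH_inf_minus RH_inf_const)
  note cST = RH_inf_carrier[OF ST(1)] RH_inf_carrier[OF ST(2)]
  have cA: "?A \<in> carrier_mat (n + q) (n + q)" using assms by simp
  define \<Omega> where "\<Omega> = resolvent ?A * (S @\<^sub>r T)"
  have R: "\<Omega> \<in> RH_inf (n + q) p" unfolding \<Omega>_def
    by (rule RH_inf_mult[OF resolvent_stable[OF cA schur]]) (use ST RH_inf_append_rows[OF cST] in blast)
  obtain x \<xi> where x: "x \<in> carrier_mat n p" and \<xi>: "\<xi> \<in> carrier_mat q p" and \<Omega>: "\<Omega> = x @\<^sub>r \<xi>"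
    using append_rows_split[OF RH_inf_carrier[OF R]] by metis
  have RH: "x \<in> RH_inf n p" "\<xi> \<in> RH_inf q p" using R RH_inf_append_rows[OF x \<xi>] \<Omega> by auto
  have "indet_z \<cdot>\<^sub>m \<Omega> = ?c ?A * \<Omega> + (S @\<^sub>r T)"
    using state_equation_iff[OF cA RH_inf_carrier[OF R] carrier_append_rows[OF cST]] \<Omega>_def by blast
  then have e: "indet_z \<cdot>\<^sub>m x = ?c (A + B * D\<^sub>K * C) * x + ?c (B * C\<^sub>K) * \<xi> + S"
     "indet_z \<cdot>\<^sub>m \<xi> = ?c (B\<^sub>K * C) * x + ?c A\<^sub>K * \<xi> + T"
    unfolding \<Omega> using assms cST x \<xi> by (subst (asm) block_state_equation[of _ n _ q _ _ _ p]; simp)+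
  define X where "X = ?c C * x + U"
  define Y where "Y = ?c C\<^sub>K * \<xi> + ?c D\<^sub>K * X"
  have X: "X \<in> RH_inf p p" unfolding X_def by (intro RH_inf_add RH_inf_mult[OF RH_inf_const RH(1)] C U)
  have Y: "Y \<in> RH_inf m p" unfolding Y_def
    by (intro RH_inf_add RH_inf_mult[OF RH_inf_const RH(2)] RH_inf_mult[OF RH_inf_const X] CK DK)
  note cX = RH_inf_carrier[OF X] and cY = RH_inf_carrier[OF Y]
  have cc: "?c (A + B * D\<^sub>K * C) = ?c A + ?c B * (?c D\<^sub>K * ?c C)"
    "?c (B * C\<^sub>K) = ?c B * ?c C\<^sub>K" "?c (B\<^sub>K * C) = ?c B\<^sub>K * ?c C"
    using A B C BK CK DK
    by (simp_all add: const_tmat_add[OF A mult_carrier_mat[OF B mult_carrier_mat[OF DK C]]]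
      const_tmat_mult[OF mult_carrier_mat[OF B DK] C] const_tmat_mult[OF B DK] const_tmat_mult[OF B CK]
      const_tmat_mult[OF BK C] const_tmat_mult[OF B mult_carrier_mat[OF DK C]] const_tmat_mult[OF DK C])
  have ex: "indet_z \<cdot>\<^sub>m x = ?c A * x + ?c B * (Y - V)"
    unfolding e cc S_def Y_def X_def using A B C CK DK x \<xi> cU cV
    by (intro eq_matI) (simp_all add: mat_expand del: index_mult_mat(1))
  have ey: "indet_z \<cdot>\<^sub>m \<xi> = ?c A\<^sub>K * \<xi> + ?c B\<^sub>K * X"
    unfolding e cc T_def X_def using C AK BK x \<xi> cU
    by (intro eq_matI) (simp_all add: mat_expand del: index_mult_mat(1))
  let ?G = "transfer_matrix A B C (0\<^sub>m p m)"
  have G: "?G \<in> carrier_mat p m" by (rule transfer_matrix_carrier[OF A B C zero_carrier_mat])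
  have "?G * (Y - V) = ?c C * x + ?c (0\<^sub>m p m) * (Y - V)"
    by (rule transfer_matrix_mult[OF A B C _ x _ ex]) (use cY cV in auto)
  then have Gx: "?G * (Y - V) = ?c C * x" using cY cV C x by (simp add: const_tmat_zero)
  have YK: "Y = transfer_matrix A\<^sub>K B\<^sub>K C\<^sub>K D\<^sub>K * X"
    unfolding Y_def by (rule transfer_matrix_mult[OF AK BK CK DK \<xi> cX ey, symmetric])
  have "M * X - N * Y = M * U - N * V"
    unfolding X_def Gx[symmetric] MG[symmetric] using M G cU cV cY
    by (intro eq_matI) (simp_all add: mat_expand del: index_mult_mat(1))
  with bezout X Y YK show ?thesis by auto
qed

text \<open>
  The equation \<open>M X - N Y = I\<close> with \<open>Y = K X\<close> exhibits \<open>M - N K\<close> as a left inverse of \<open>X\<close>.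
\<close>

lemma factor_invertible:
  assumes M: "(M :: 'a :: field mat) \<in> carrier_mat p p" and X: "X \<in> carrier_mat p p" and K: "K \<in> carrier_mat m p"
    and N: "N \<in> carrier_mat p m"
    and e: "M * X - N * Y = 1\<^sub>m p" and Y: "Y = K * X"
  shows "invertible_mat X" and "K = Y * minv X"
proof -
  have l: "(M - N * K) * X = 1\<^sub>m p" using e Y M X K N by (simp add: mat_expand)
  have r: "X * (M - N * K) = 1\<^sub>m p" by (rule mat_mult_left_right_inverse[OF _ X l]) (use M N K in auto)
  show inv: "invertible_mat X" by (rule minv_unique(1)[OF X _ r]) (use M N K in auto)
  have "Y * minv X = K * (X * minv X)"
    unfolding Y using minv_inverts(1)[OF X inv] X K by (simp add: mat_expand)
  then show "K = Y * minv X" using minv_inverts(2)[OF X inv] K by simp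
qed

text \<open>
  The Bezout identity is the lower right block of the doubly-coprime identity.
\<close>

lemma doubly_coprime_factorizationD:
  assumes "doubly_coprime_factorization p m G U\<^sub>l V\<^sub>l N\<^sub>l M\<^sub>l U\<^sub>r V\<^sub>r N\<^sub>r M\<^sub>r"
  shows "M\<^sub>l * U\<^sub>r - N\<^sub>l * V\<^sub>r = 1\<^sub>m p" and "M\<^sub>l * G = N\<^sub>l"
proof -
  note d = assms[unfolded doubly_coprime_factorization_def]
  have car: "U\<^sub>l \<in> carrier_mat m m" "- V\<^sub>l \<in> carrier_mat m p" "- N\<^sub>l \<in> carrier_mat p m" "M\<^sub>l \<in> carrier_mat p p"
    "M\<^sub>r \<in> carrier_mat m m" "V\<^sub>r \<in> carrier_mat m p" "N\<^sub>r \<in> carrier_mat p m" "U\<^sub>r \<in> carrier_mat p p"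
    using d by (auto intro: RH_inf_carrier)
  have cN: "N\<^sub>l \<in> carrier_mat p m" using d by (auto intro: RH_inf_carrier)
  have e: "four_block_mat (U\<^sub>l * M\<^sub>r + - V\<^sub>l * N\<^sub>r) (U\<^sub>l * V\<^sub>r + - V\<^sub>l * U\<^sub>r)
      (- N\<^sub>l * M\<^sub>r + M\<^sub>l * N\<^sub>r) (- N\<^sub>l * V\<^sub>r + M\<^sub>l * U\<^sub>r) = 1\<^sub>m (m + p)"
    using d mult_four_block_mat[OF car] by simp
  have neg: "- N\<^sub>l * V\<^sub>r = - (N\<^sub>l * V\<^sub>r)" using cN car by simp
  show "M\<^sub>l * U\<^sub>r - N\<^sub>l * V\<^sub>r = 1\<^sub>m p"
  proof (rule eq_matI)
    fix i j assume "i < dim_row (1\<^sub>m p)" "j < dim_col (1\<^sub>m p)"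
    then have ij: "i < p" "j < p" by auto
    show "(M\<^sub>l * U\<^sub>r - N\<^sub>l * V\<^sub>r) $$ (i, j) = 1\<^sub>m p $$ (i, j)"
      using arg_cong[OF e, of "\<lambda>M. M $$ (m + i, m + j)"] ij car cN
      by (simp add: neg del: index_mult_mat(1))
  qed (use car cN in auto)
  have inv: "invertible_mat M\<^sub>l" and G: "G = minv M\<^sub>l * N\<^sub>l" using d by auto
  note mi = minv_inverts[OF car(4) inv]
  have "M\<^sub>l * G = (M\<^sub>l * minv M\<^sub>l) * N\<^sub>l" unfolding G using mi(1) cN car by (simp add: mat_expand)
  then show "M\<^sub>l * G = N\<^sub>l" using mi cN by simp
qed

section \<open>The Youla parameter of a coprime factor\<close>

text \<open>
  Fix a state feedback \<open>F\<close> and an observer gain \<open>L\<close> for the plant. The normalization of the right factor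
  \<open>(X, Y)\<close> that comes with the given left factorization \<open>(M, N)\<close> is changed by a right factor \<open>W\<close> to the
  one that comes with the observer: the estimation error \<open>X W - C x\<close> becomes the identity, where \<open>x\<close> is
  the observer state driven by the plant input \<open>Y W\<close> and the output \<open>X W\<close>. What the control input \<open>Y W\<close>
  contains beyond the state feedback \<open>F x\<close> is the Youla parameter \<open>Q\<close>.

  The matrix \<open>W\<close> is \<open>M\<close> times the inverse \<open>I - C (z I - A)^-1 L\<close> of the left denominator built from \<open>L\<close>.
  Stability of \<open>W\<close> is not obvious, as \<open>(z I - A)^-1\<close> may be unstable; it follows by rewriting
  \<open>M C (z I - A)^-1\<close> through the stable resolvent of \<open>A + B F\<close> and \<open>M G = N\<close>.
\<close>

lemma youla_parameter:
  assumes A: "A \<in> carrier_mat n n" and B: "B \<in> carrier_mat n m" and C: "C \<in> carrier_mat p n"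
    and F: "F \<in> carrier_mat m n" and L: "L \<in> carrier_mat n p"
    and sF: "schur_stable (A + B * F)" and sL: "schur_stable (A + L * C)"
    and M: "M \<in> RH_inf p p" and N: "N \<in> RH_inf p m" and X: "X \<in> RH_inf p p" and Y: "Y \<in> RH_inf m p"
    and bezout: "M * X - N * Y = 1\<^sub>m p" and MG: "M * transfer_matrix A B C (0\<^sub>m p m) = N"
  shows "\<exists>W x Q. W \<in> carrier_mat p p \<and> x \<in> carrier_mat n p \<and> Q \<in> RH_inf m p \<and>
    X * W = const_tmat C * x + 1\<^sub>m p \<and> Y * W = const_tmat F * x + Q \<and>
    indet_z \<cdot>\<^sub>m x = const_tmat (A + B * F) * x + (const_tmat B * Q - const_tmat L)"
proof -
  let ?c = const_tmat
  let ?G = "transfer_matrix A B C (0\<^sub>m p m)"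
  define R where "R = resolvent A"
  define RF where "RF = resolvent (A + B * F)"
  have AF: "A + B * F \<in> carrier_mat n n" and AL: "A + L * C \<in> carrier_mat n n" using A B C F L by auto
  have cR: "R \<in> carrier_mat n n" using resolvent_inverse(1)[OF A] by (simp add: R_def)
  have RF: "RF \<in> RH_inf n n" unfolding RF_def by (rule resolvent_stable[OF AF sF])
  note cRF = RH_inf_carrier[OF RF]
  note cM = RH_inf_carrier[OF M] and cN = RH_inf_carrier[OF N] and cX = RH_inf_carrier[OF X] and cY = RH_inf_carrier[OF Y]
  have cBF: "?c (A + B * F) = ?c A + ?c B * ?c F" "?c (A + L * C) = ?c A + ?c L * ?c C"
    by (simp_all add: const_tmat_add[OF A mult_carrier_mat[OF B F]] const_tmat_mult[OF B F]
        const_tmat_add[OF A mult_carrier_mat[OF L C]] const_tmat_mult[OF L C])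
  have G: "?G = ?c C * R * ?c B" using B C cR by (simp add: transfer_matrix_eq R_def const_tmat_zero)
  have cG: "?G \<in> carrier_mat p m" by (rule transfer_matrix_carrier[OF A B C zero_carrier_mat])
  have "indet_z \<cdot>\<^sub>m RF = ?c (A + B * F) * RF + 1\<^sub>m n"
    using state_equation_iff[OF AF cRF one_carrier_mat] cRF by (simp add: RF_def)
  then have "indet_z \<cdot>\<^sub>m RF = ?c A * RF + (?c B * ?c F * RF + 1\<^sub>m n)"
    unfolding cBF using A B F cRF by (simp add: mat_expand assoc_add_mat[of _ n n])
  then have RF_eq: "RF = R * (?c B * ?c F * RF + 1\<^sub>m n)"
    unfolding R_def using state_equation_iff[OF A cRF] B F cRF by simp
  \<comment> \<open>a manifestly stable expression for \<open>M C (z I - A)^-1\<close>\<close>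
  define H where "H = M * ?c C * RF - N * ?c F * RF"
  have H: "H \<in> RH_inf p n" unfolding H_def
    by (intro RH_inf_minus RH_inf_mult[OF _ RF] RH_inf_mult[OF M] RH_inf_mult[OF N] RH_inf_const C F)
  have H_eq: "H = M * ?c C * R"
  proof -
    have "M * ?c C * RF = M * ?c C * R * ?c B * ?c F * RF + M * ?c C * R"
      by (subst RF_eq) (use cM cR A B C F cRF in \<open>simp add: mat_expand\<close>)
    moreover have "N * ?c F * RF = M * ?c C * R * ?c B * ?c F * RF"
      unfolding MG[symmetric] G using cM cR B C F cRF by (simp add: mat_expand)
    ultimately show ?thesis unfolding H_def using cM cR B C F cRF
      by (intro eq_matI) (simp_all del: index_mult_mat(1))
  qed
  define W where "W = M - H * ?c L"
  have W: "W \<in> RH_inf p p" unfolding W_def by (intro RH_inf_minus M RH_inf_mult[OF H] RH_inf_const L)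
  note cW = RH_inf_carrier[OF W]
  have XW: "X * W \<in> RH_inf p p" and YW: "Y * W \<in> RH_inf m p" by (rule RH_inf_mult[OF X W] RH_inf_mult[OF Y W])+
  note cXW = RH_inf_carrier[OF XW] and cYW = RH_inf_carrier[OF YW]
  have "M * (X - ?G * Y) = 1\<^sub>m p" using bezout cM cX cY cG by (simp add: MG[symmetric] mat_expand)
  then have inv: "(X - ?G * Y) * M = 1\<^sub>m p"
    by (intro mat_mult_left_right_inverse[OF cM]) (use cX cY cG in auto)
  have "X * W - ?G * (Y * W) = (X - ?G * Y) * W" using cX cY cG cW by (simp add: mat_expand)
  also have "\<dots> = (X - ?G * Y) * M - (X - ?G * Y) * M * (?c C * R * ?c L)"
    unfolding W_def H_eq using cX cY cG cM C cR L by (simp add: mat_expand)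
  also have "\<dots> = 1\<^sub>m p - ?c C * R * ?c L" unfolding inv using C cR L by simp
  finally have XGY: "X * W - ?G * (Y * W) = 1\<^sub>m p - ?c C * R * ?c L" .
  \<comment> \<open>the state of the plant under the input \<open>Y W\<close> and the disturbance \<open>- L\<close>; as \<open>X W = C x + I\<close>, it is also the observer state, and therefore stable\<close>
  define x where "x = R * (?c B * (Y * W) - ?c L)"
  have x: "x \<in> carrier_mat n p" unfolding x_def using cR L
    by (intro mult_carrier_mat[of _ n n] minus_carrier_mat) auto
  have XWx: "X * W = ?c C * x + 1\<^sub>m p"
  proof (rule eq_matI)
    fix i j assume "i < dim_row (?c C * x + 1\<^sub>m p)" "j < dim_col (?c C * x + 1\<^sub>m p)"
    then have ij: "i < p" "j < p" by auto
    have "?c C * x = ?G * (Y * W) - ?c C * R * ?c L"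
      unfolding x_def G using C cR B L cYW cY cW by (simp add: mat_expand)
    then show "(X * W) $$ (i, j) = (?c C * x + 1\<^sub>m p) $$ (i, j)"
      using arg_cong[OF XGY, of "\<lambda>M. M $$ (i, j)"] ij cXW cYW cX cY cW cG C cR L
      by (simp add: algebra_simps del: index_mult_mat(1) assoc_mult_mat)
  qed (use cXW in auto)
  have zx: "indet_z \<cdot>\<^sub>m x = ?c A * x + (?c B * (Y * W) - ?c L)"
    using state_equation_iff[OF A x minus_carrier_mat, of "?c L" "?c B * (Y * W)"] L
    by (simp add: x_def R_def)
  have "indet_z \<cdot>\<^sub>m x = ?c (A + L * C) * x + (?c B * (Y * W) - ?c L * (X * W))"
    unfolding zx cBF XWx using A B C L x cYW cY cW
    by (intro eq_matI) (simp_all add: mat_expand del: index_mult_mat(1))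
  then have "x = resolvent (A + L * C) * (?c B * (Y * W) - ?c L * (X * W))"
    using state_equation_iff[OF AL x minus_carrier_mat, of "?c L * (X * W)" "?c B * (Y * W)"] L cXW
    by simp
  then have xRH: "x \<in> RH_inf n p"
    using RH_inf_mult[OF resolvent_stable[OF AL sL]
      RH_inf_minus[OF RH_inf_mult[OF RH_inf_const[OF B] YW] RH_inf_mult[OF RH_inf_const[OF L] XW]]] by simp
  define Q where "Q = Y * W - ?c F * x"
  have Q: "Q \<in> RH_inf m p" unfolding Q_def by (intro RH_inf_minus YW RH_inf_mult[OF RH_inf_const[OF F] xRH])
  have "Y * W = ?c F * x + Q" unfolding Q_def using cY cW F x
    by (intro eq_matI) (simp_all del: index_mult_mat(1))
  moreover have "indet_z \<cdot>\<^sub>m x = ?c (A + B * F) * x + (?c B * Q - ?c L)"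
    unfolding zx cBF Q_def using A B F L x cYW cY cW
    by (intro eq_matI) (simp_all add: mat_expand del: index_mult_mat(1))
  ultimately show ?thesis using cW x Q XWx by blast
qed

lemma append_cols_mult_vec:
  fixes P :: "'a :: comm_ring_1 mat"
  assumes "P \<in> carrier_mat r a" "Q \<in> carrier_mat r b" "v \<in> carrier_vec a" "w \<in> carrier_vec b"
  shows "append_cols P Q *\<^sub>v (v @\<^sub>v w) = P *\<^sub>v v + Q *\<^sub>v w"
proof -
  have "append_cols P Q *\<^sub>v (v @\<^sub>v w) = (P *\<^sub>v v + Q *\<^sub>v w) @\<^sub>v (0\<^sub>m 0 a *\<^sub>v v + 0\<^sub>m 0 b *\<^sub>v w)"
    unfolding append_cols_def using assms by (subst four_block_mat_mult_vec[of _ r a _ b _ 0]) auto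
  also have "\<dots> = P *\<^sub>v v + Q *\<^sub>v w" using assms by (intro eq_vecI) auto
  finally show ?thesis .
qed

section \<open>Observer-based controllers with a stable free parameter\<close>

text \<open>
  The controller runs an observer with state \<open>x\<close> and lets the estimation error \<open>e = y - C x\<close> drive a
  stable system \<open>Q\<close> with state \<open>q\<close>, whose output is added to the state feedback:
  \<open>x' = A x + B u - L e\<close>, \<open>q' = A\<^sub>Q q + B\<^sub>Q e\<close>, \<open>u = F x + C\<^sub>Q q + D\<^sub>Q e\<close>. Eliminating \<open>u\<close> and \<open>e\<close> gives the
  matrices below; \<open>A\<^sub>E\<close> is the state matrix that remains when \<open>e\<close> instead of \<open>y\<close> is taken as the input.
\<close>

locale observer_controller =
  fixes n m p r :: nat and A B C F L A\<^sub>Q B\<^sub>Q C\<^sub>Q D\<^sub>Q :: "real mat"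
  assumes A: "A \<in> carrier_mat n n" and B: "B \<in> carrier_mat n m" and C: "C \<in> carrier_mat p n"
    and F: "F \<in> carrier_mat m n" and L: "L \<in> carrier_mat n p"
    and AQ: "A\<^sub>Q \<in> carrier_mat r r" and BQ: "B\<^sub>Q \<in> carrier_mat r p"
    and CQ: "C\<^sub>Q \<in> carrier_mat m r" and DQ: "D\<^sub>Q \<in> carrier_mat m p"
    and sF: "schur_stable (A + B * F)" and sL: "schur_stable (A + L * C)" and sQ: "schur_stable A\<^sub>Q"
begin

definition "A\<^sub>K = four_block_mat (A + B * F - (B * D\<^sub>Q - L) * C) (B * C\<^sub>Q) (- (B\<^sub>Q * C)) A\<^sub>Q"
definition "B\<^sub>K = (B * D\<^sub>Q - L) @\<^sub>r B\<^sub>Q"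
definition "C\<^sub>K = append_cols (F - D\<^sub>Q * C) C\<^sub>Q"
definition "A\<^sub>E = four_block_mat (A + B * F) (B * C\<^sub>Q) (0\<^sub>m r n) A\<^sub>Q"

lemma carriers: "A\<^sub>K \<in> carrier_mat (n + r) (n + r)" "B\<^sub>K \<in> carrier_mat (n + r) p" "C\<^sub>K \<in> carrier_mat m (n + r)"
  "A\<^sub>E \<in> carrier_mat (n + r) (n + r)"
  using A B C F L AQ BQ CQ DQ by (auto simp: A\<^sub>K_def B\<^sub>K_def C\<^sub>K_def A\<^sub>E_def intro!: append_cols_carrier carrier_append_rows)

lemma AE_schur: "schur_stable A\<^sub>E"
  unfolding A\<^sub>E_def by (rule schur_stable_block(1)) (use A B F AQ CQ sF sQ in auto)

text \<open>
  Feeding back \<open>y = C x\<close> makes the estimation error vanish, which leaves \<open>A\<^sub>E\<close>.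
\<close>

lemma stabilizable_controller: "stabilizable A\<^sub>K B\<^sub>K"
proof -
  have "A\<^sub>K + B\<^sub>K * append_cols C (0\<^sub>m p r) = A\<^sub>E"
  proof -
    have "B\<^sub>K * append_cols C (0\<^sub>m p r) =
        four_block_mat ((B * D\<^sub>Q - L) * C) ((B * D\<^sub>Q - L) * 0\<^sub>m p r) (B\<^sub>Q * C) (B\<^sub>Q * 0\<^sub>m p r)"
      unfolding B\<^sub>K_def by (rule append_rows_mult_append_cols) (use B C L BQ DQ in auto)
    then have "A\<^sub>K + B\<^sub>K * append_cols C (0\<^sub>m p r) =
        four_block_mat (A + B * F - (B * D\<^sub>Q - L) * C + (B * D\<^sub>Q - L) * C)
          (B * C\<^sub>Q + (B * D\<^sub>Q - L) * 0\<^sub>m p r) (- (B\<^sub>Q * C) + B\<^sub>Q * C) (A\<^sub>Q + B\<^sub>Q * 0\<^sub>m p r)"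
      unfolding A\<^sub>K_def by (simp only:)
        (rule add_four_block_mat[of _ n n _ r _ r], use A B C F L AQ BQ CQ DQ in auto)
    also have "\<dots> = A\<^sub>E" unfolding A\<^sub>E_def
    proof (rule cong_four_block_mat)
      show "A + B * F - (B * D\<^sub>Q - L) * C + (B * D\<^sub>Q - L) * C = A + B * F"
        using A B C F L by (intro eq_matI) (simp_all del: index_mult_mat(1))
    qed (use B C L AQ BQ CQ in \<open>auto simp: right_mult_zero_mat[of _ _ p]\<close>)
    finally show ?thesis .
  qed
  moreover have "append_cols C (0\<^sub>m p r) \<in> carrier_mat (dim_col B\<^sub>K) (dim_row A\<^sub>K)"
    using carriers C append_cols_carrier[OF C zero_carrier_mat] by auto
  ultimately show ?thesis unfolding stabilizable_def using AE_schur by metis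
qed

text \<open>
  Injecting the control input \<open>u\<close> with gain \<open>- B\<close> into the observer state removes \<open>u\<close> from the
  observer equation, which leaves the error dynamics \<open>A + L C\<close> followed by \<open>A\<^sub>Q\<close>.
\<close>

lemma detectable_controller: "detectable C\<^sub>K A\<^sub>K"
proof -
  let ?L = "(- B) @\<^sub>r 0\<^sub>m r m"
  have "A\<^sub>K + ?L * C\<^sub>K = four_block_mat (A + L * C) (0\<^sub>m n r) (- (B\<^sub>Q * C)) A\<^sub>Q"
  proof -
    have "?L * C\<^sub>K = four_block_mat (- B * (F - D\<^sub>Q * C)) (- B * C\<^sub>Q) (0\<^sub>m r m * (F - D\<^sub>Q * C)) (0\<^sub>m r m * C\<^sub>Q)"
      unfolding C\<^sub>K_def by (rule append_rows_mult_append_cols) (use B C F CQ DQ in auto)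
    then have "A\<^sub>K + ?L * C\<^sub>K =
        four_block_mat (A + B * F - (B * D\<^sub>Q - L) * C + - B * (F - D\<^sub>Q * C)) (B * C\<^sub>Q + - B * C\<^sub>Q)
          (- (B\<^sub>Q * C) + 0\<^sub>m r m * (F - D\<^sub>Q * C)) (A\<^sub>Q + 0\<^sub>m r m * C\<^sub>Q)"
      unfolding A\<^sub>K_def by (simp only:)
        (rule add_four_block_mat[of _ n n _ r _ r], use A B C F L AQ BQ CQ DQ in auto)
    also have "\<dots> = four_block_mat (A + L * C) (0\<^sub>m n r) (- (B\<^sub>Q * C)) A\<^sub>Q"
    proof (rule cong_four_block_mat)
      show "A + B * F - (B * D\<^sub>Q - L) * C + - B * (F - D\<^sub>Q * C) = A + L * C"
        using A B C F L DQ by (intro eq_matI) (simp_all add: mat_expand del: index_mult_mat(1))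
      show "B * C\<^sub>Q + - B * C\<^sub>Q = 0\<^sub>m n r"
        using B CQ by (intro eq_matI) (simp_all del: index_mult_mat(1))
      show "- (B\<^sub>Q * C) + 0\<^sub>m r m * (F - D\<^sub>Q * C) = - (B\<^sub>Q * C)" "A\<^sub>Q + 0\<^sub>m r m * C\<^sub>Q = A\<^sub>Q"
        using F C DQ BQ CQ AQ by (intro eq_matI; simp)+
    qed
    finally show ?thesis .
  qed
  moreover have "schur_stable (four_block_mat (A + L * C) (0\<^sub>m n r) (- (B\<^sub>Q * C)) A\<^sub>Q)"
    by (rule schur_stable_block(2)) (use A C L AQ BQ sL sQ in auto)
  moreover have "?L \<in> carrier_mat (dim_row A\<^sub>K) (dim_row C\<^sub>K)"
    using carriers carrier_append_rows[OF uminus_carrier_mat[OF B] zero_carrier_mat[of r m]] by auto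
  ultimately show ?thesis unfolding detectable_def by metis
qed

text \<open>
  Take the estimation error, here the identity matrix, as the input of the controller: the measurement
  is then \<open>X = C x + I\<close> and the control input is \<open>Y = F x + Q\<close>. As the direct term of \<open>X\<close> is the
  identity, reading the system backwards (from measurement to error) gives an explicit inverse of \<open>X\<close>.
\<close>

lemma controller_factorization:
  assumes Q: "Q = transfer_matrix A\<^sub>Q B\<^sub>Q C\<^sub>Q D\<^sub>Q" and x: "x \<in> carrier_mat n p"
    and zx: "indet_z \<cdot>\<^sub>m x = const_tmat (A + B * F) * x + (const_tmat B * Q - const_tmat L)"
  defines "X \<equiv> const_tmat C * x + 1\<^sub>m p" and "Y \<equiv> const_tmat F * x + Q"
  shows "Y = transfer_matrix A\<^sub>K B\<^sub>K C\<^sub>K D\<^sub>Q * X" and "invertible_mat X"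
proof -
  let ?c = const_tmat
  define q where "q = resolvent A\<^sub>Q * ?c B\<^sub>Q"
  have q: "q \<in> carrier_mat r p" using resolvent_inverse(1)[OF AQ] BQ by (simp add: q_def)
  have zq: "indet_z \<cdot>\<^sub>m q = ?c A\<^sub>Q * q + ?c B\<^sub>Q"
    using state_equation_iff[OF AQ q, of "?c B\<^sub>Q"] BQ by (simp add: q_def)
  have Qq: "Q = ?c C\<^sub>Q * q + ?c D\<^sub>Q" unfolding Q by (rule transfer_matrixI[OF AQ BQ CQ DQ q zq])
  have X: "X \<in> carrier_mat p p" using C x by (simp add: X_def)
  have cc: "?c (B * D\<^sub>Q - L) = ?c B * ?c D\<^sub>Q - ?c L" "?c (- (B\<^sub>Q * C)) = - (?c B\<^sub>Q * ?c C)" "?c (B * C\<^sub>Q) = ?c B * ?c C\<^sub>Q"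
    "?c (F - D\<^sub>Q * C) = ?c F - ?c D\<^sub>Q * ?c C"
    "?c (A + B * F - (B * D\<^sub>Q - L) * C) = ?c (A + B * F) - (?c B * ?c D\<^sub>Q - ?c L) * ?c C"
  proof -
    show bd: "?c (B * D\<^sub>Q - L) = ?c B * ?c D\<^sub>Q - ?c L"
      by (simp add: const_tmat_minus[OF mult_carrier_mat[OF B DQ] L] const_tmat_mult[OF B DQ])
    have cbd: "B * D\<^sub>Q - L \<in> carrier_mat n p" by (rule minus_carrier_mat[OF L])
    show "?c (A + B * F - (B * D\<^sub>Q - L) * C) = ?c (A + B * F) - (?c B * ?c D\<^sub>Q - ?c L) * ?c C"
      unfolding bd[symmetric] const_tmat_mult[OF cbd C, symmetric]
      by (rule const_tmat_minus[of _ n n]) (use A B F C cbd in auto)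
    show "?c (- (B\<^sub>Q * C)) = - (?c B\<^sub>Q * ?c C)" by (simp add: const_tmat_uminus const_tmat_mult[OF BQ C])
    show "?c (B * C\<^sub>Q) = ?c B * ?c C\<^sub>Q" by (rule const_tmat_mult[OF B CQ])
    show "?c (F - D\<^sub>Q * C) = ?c F - ?c D\<^sub>Q * ?c C"
      by (simp add: const_tmat_minus[OF F mult_carrier_mat[OF DQ C]] const_tmat_mult[OF DQ C])
  qed
  have e1: "indet_z \<cdot>\<^sub>m x = ?c (A + B * F - (B * D\<^sub>Q - L) * C) * x + ?c (B * C\<^sub>Q) * q + ?c (B * D\<^sub>Q - L) * X"
    unfolding zx cc Qq X_def using A B C F L CQ DQ x q
    by (intro eq_matI) (simp_all add: mat_expand del: index_mult_mat(1))
  have e2: "indet_z \<cdot>\<^sub>m q = ?c (- (B\<^sub>Q * C)) * x + ?c A\<^sub>Q * q + ?c B\<^sub>Q * X"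
    unfolding zq cc X_def using C AQ BQ x q
    by (intro eq_matI) (simp_all add: mat_expand del: index_mult_mat(1))
  have BKX: "?c B\<^sub>K * X = (?c (B * D\<^sub>Q - L) * X) @\<^sub>r (?c B\<^sub>Q * X)"
  proof -
    have cbd: "B * D\<^sub>Q - L \<in> carrier_mat n p" by (rule minus_carrier_mat[OF L])
    show ?thesis unfolding B\<^sub>K_def const_tmat_append_rows[OF cbd BQ] using cbd BQ X
      by (intro eq_matI) (auto simp: scalar_prod_def)
  qed
  have s: "x @\<^sub>r q \<in> carrier_mat (n + r) p" using x q by simp
  have st: "indet_z \<cdot>\<^sub>m (x @\<^sub>r q) = ?c A\<^sub>K * (x @\<^sub>r q) + ?c B\<^sub>K * X"
    unfolding BKX A\<^sub>K_def
  proof (subst block_state_equation[of _ n _ r _ _ _ p])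
    have bd: "B * D\<^sub>Q - L \<in> carrier_mat n p" by (rule minus_carrier_mat[OF L])
    show "A + B * F - (B * D\<^sub>Q - L) * C \<in> carrier_mat n n"
      by (rule minus_carrier_mat[OF mult_carrier_mat[OF bd C]])
    show "?c (B * D\<^sub>Q - L) * X \<in> carrier_mat n p"
      by (rule mult_carrier_mat[OF _ X]) (use bd in simp)
    show "indet_z \<cdot>\<^sub>m x = ?c (A + B * F - (B * D\<^sub>Q - L) * C) * x + ?c (B * C\<^sub>Q) * q + ?c (B * D\<^sub>Q - L) * X \<and>
      indet_z \<cdot>\<^sub>m q = ?c (- (B\<^sub>Q * C)) * x + ?c A\<^sub>Q * q + ?c B\<^sub>Q * X"
      by (rule conjI[OF e1 e2])
  qed (use B C AQ BQ CQ X x q in simp_all)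
  have "transfer_matrix A\<^sub>K B\<^sub>K C\<^sub>K D\<^sub>Q * X = ?c C\<^sub>K * (x @\<^sub>r q) + ?c D\<^sub>Q * X"
    by (rule transfer_matrix_mult[OF carriers(1-3) DQ s X st])
  also have "?c C\<^sub>K * (x @\<^sub>r q) = ?c (F - D\<^sub>Q * C) * x + ?c C\<^sub>Q * q"
  proof -
    have FC: "F - D\<^sub>Q * C \<in> carrier_mat m n" by (rule minus_carrier_mat[OF mult_carrier_mat[OF DQ C]])
    show ?thesis unfolding C\<^sub>K_def const_tmat_append_cols[OF FC CQ]
      by (rule append_cols_mult_append_rows[of _ m n _ r _ p]) (use FC CQ x q in auto)
  qed
  also have "\<dots> + ?c D\<^sub>Q * X = Y"
    unfolding cc X_def Y_def Qq using F C CQ DQ x q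
    by (intro eq_matI) (simp_all add: mat_expand del: index_mult_mat(1))
  finally show "Y = transfer_matrix A\<^sub>K B\<^sub>K C\<^sub>K D\<^sub>Q * X" ..
  let ?C1 = "append_cols C (0\<^sub>m p r)"
  let ?T = "transfer_matrix A\<^sub>K B\<^sub>K ?C1 (0\<^sub>m p p)"
  have C1: "?C1 \<in> carrier_mat p (n + r)" by (rule append_cols_carrier[OF C zero_carrier_mat])
  have T: "?T \<in> carrier_mat p p" by (rule transfer_matrix_carrier[OF carriers(1,2) C1 zero_carrier_mat])
  have "?T * X = ?c ?C1 * (x @\<^sub>r q) + ?c (0\<^sub>m p p) * X"
    by (rule transfer_matrix_mult[OF carriers(1,2) C1 zero_carrier_mat s X st])
  also have "?c ?C1 * (x @\<^sub>r q) = ?c C * x + 0\<^sub>m p r * q"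
    using C x q by (simp add: const_tmat_append_cols[of _ p n _ r] append_cols_mult_append_rows[of _ p n _ r _ p] const_tmat_zero)
  \<comment> \<open>\<open>T\<close> maps the measurement to the predicted output \<open>C x\<close>, so \<open>I - T\<close> maps it to the estimation error\<close>
  finally have TX: "?T * X = ?c C * x" using C x q X by (simp add: const_tmat_zero)
  have "(1\<^sub>m p - ?T) * X = X - ?T * X" using T X by (simp add: mat_expand)
  also have "\<dots> = 1\<^sub>m p" unfolding TX using C x unfolding X_def
    by (intro eq_matI) (simp_all del: index_mult_mat(1))
  finally have l: "(1\<^sub>m p - ?T) * X = 1\<^sub>m p" .
  have "X * (1\<^sub>m p - ?T) = 1\<^sub>m p" by (rule mat_mult_left_right_inverse[OF _ X l]) (use T in auto)
  then show "invertible_mat X" using T by (intro minv_unique(1)[OF X]) auto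
qed

text \<open>
  Separation principle: let \<open>h\<close> be the observer part of the controller state \<open>\<xi>\<close>. In the coordinates
  \<open>d = x - h\<close> and \<open>\<xi>\<close> the loop is block triangular with the stable diagonal blocks \<open>A + L C\<close> and \<open>A\<^sub>E\<close>.
\<close>

lemma internally_stable: "internally_stable_loop n m p (n + r) A B C A\<^sub>K B\<^sub>K C\<^sub>K D\<^sub>Q"
proof -
  have wp: "well_posed n m p (n + r) C C\<^sub>K D\<^sub>Q"
    unfolding well_posed_def
  proof (intro ballI)
    fix x \<xi> \<delta>y \<delta>u :: "real vec"
    assume "\<delta>y \<in> carrier_vec p" "\<delta>u \<in> carrier_vec m"
    then show "\<exists>!(u, y). u \<in> carrier_vec m \<and> y \<in> carrier_vec p \<and>
        y = C *\<^sub>v x + \<delta>y \<and> u = C\<^sub>K *\<^sub>v \<xi> + D\<^sub>Q *\<^sub>v y + \<delta>u"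
      by (intro ex1I[of _ "(C\<^sub>K *\<^sub>v \<xi> + D\<^sub>Q *\<^sub>v (C *\<^sub>v x + \<delta>y) + \<delta>u, C *\<^sub>v x + \<delta>y)"])
        (auto intro!: carrier_vecI)
  qed
  have "vec_tendsto_zero n x \<and> vec_tendsto_zero (n + r) \<xi>"
    if pl: "plant_eqs n m p A B C (\<lambda>_. 0\<^sub>v n) (\<lambda>_. 0\<^sub>v p) x u y"
      and co: "controller_eqs (n + r) m p A\<^sub>K B\<^sub>K C\<^sub>K D\<^sub>Q (\<lambda>_. 0\<^sub>v m) \<xi> u y" for x \<xi> u y
  proof -
    have x: "x t \<in> carrier_vec n" and u: "u t \<in> carrier_vec m" and y: "y t \<in> carrier_vec p"
      and \<xi>: "\<xi> t \<in> carrier_vec (n + r)" for t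
      using pl co by (auto simp: plant_eqs_def controller_eqs_def)
    have xs: "x (Suc t) = A *\<^sub>v x t + B *\<^sub>v u t" and ys: "y t = C *\<^sub>v x t" for t
      using pl A B C x[of t] u[of t] by (auto simp: plant_eqs_def)
    have \<xi>s: "\<xi> (Suc t) = A\<^sub>K *\<^sub>v \<xi> t + B\<^sub>K *\<^sub>v y t" and us: "u t = C\<^sub>K *\<^sub>v \<xi> t + D\<^sub>Q *\<^sub>v y t" for t
      using co carriers DQ \<xi>[of t] y[of t] by (auto simp: controller_eqs_def)
    define h q where "h t = vec_first (\<xi> t) n" and "q t = vec_last (\<xi> t) r" for t
    have hq: "\<xi> t = h t @\<^sub>v q t" for t using \<xi>[of t] by (simp add: h_def q_def)
    have h: "h t \<in> carrier_vec n" and q: "q t \<in> carrier_vec r" for t by (simp_all add: h_def q_def)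
    have us': "u t = (F - D\<^sub>Q * C) *\<^sub>v h t + C\<^sub>Q *\<^sub>v q t + D\<^sub>Q *\<^sub>v y t" for t
      unfolding us hq C\<^sub>K_def using F C CQ DQ h q
      by (subst append_cols_mult_vec[of _ m n _ r]) auto
    have hqs: "\<xi> (Suc t) = ((A + B * F - (B * D\<^sub>Q - L) * C) *\<^sub>v h t + (B * C\<^sub>Q) *\<^sub>v q t + (B * D\<^sub>Q - L) *\<^sub>v y t) @\<^sub>v
       (- (B\<^sub>Q * C) *\<^sub>v h t + A\<^sub>Q *\<^sub>v q t + B\<^sub>Q *\<^sub>v y t)" for t
    proof -
      have "A\<^sub>K *\<^sub>v \<xi> t = ((A + B * F - (B * D\<^sub>Q - L) * C) *\<^sub>v h t + (B * C\<^sub>Q) *\<^sub>v q t) @\<^sub>v (- (B\<^sub>Q * C) *\<^sub>v h t + A\<^sub>Q *\<^sub>v q t)"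
        unfolding A\<^sub>K_def hq by (rule four_block_mat_mult_vec) (use A B C F L AQ BQ CQ DQ h q in auto)
      moreover have "B\<^sub>K *\<^sub>v y t = ((B * D\<^sub>Q - L) *\<^sub>v y t) @\<^sub>v (B\<^sub>Q *\<^sub>v y t)"
        unfolding B\<^sub>K_def by (rule mat_mult_append[of _ n p]) (use L BQ y in auto)
      ultimately show ?thesis unfolding \<xi>s using A B C F L AQ BQ CQ DQ h[of t] q[of t] y[of t]
        by (intro eq_vecI) (auto simp del: index_mult_mat_vec)
    qed
    define d where "d t = x t - h t" for t
    have d: "d t \<in> carrier_vec n" for t using x[of t] h[of t] by (simp add: d_def)
    define z where "z t = d t @\<^sub>v \<xi> t" for t
    let ?E = "((B * D\<^sub>Q - L) * C) @\<^sub>r (B\<^sub>Q * C)"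
    let ?Z = "four_block_mat (A + L * C) (0\<^sub>m n (n + r)) ?E A\<^sub>E"
    have E: "?E \<in> carrier_mat (n + r) n" using B C L DQ BQ by (intro carrier_append_rows) auto
    have AL: "A + L * C \<in> carrier_mat n n" using A L C by simp
    have "h (Suc t) @\<^sub>v q (Suc t) = \<xi> (Suc t)" for t by (simp add: hq)
    then have hs: "h (Suc t) = (A + B * F - (B * D\<^sub>Q - L) * C) *\<^sub>v h t + (B * C\<^sub>Q) *\<^sub>v q t + (B * D\<^sub>Q - L) *\<^sub>v y t"
      for t unfolding hqs by (subst (asm) append_vec_eq[of _ n]) (use h L in \<open>auto intro!: carrier_vecI\<close>)
    \<comment> \<open>the control input reaches plant and observer alike, so it drops out of the error\<close>
    have ds: "d (Suc t) = (A + L * C) *\<^sub>v d t" for t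
      unfolding d_def xs hs us' ys using A B C F L CQ DQ x[of t] h[of t] q[of t]
      by (intro eq_vecI) (simp_all add: vec_expand del: index_mult_mat_vec)
    have \<xi>z: "\<xi> (Suc t) = ?E *\<^sub>v d t + A\<^sub>E *\<^sub>v \<xi> t" for t
    proof -
      have e1: "?E *\<^sub>v d t = (((B * D\<^sub>Q - L) * C) *\<^sub>v d t) @\<^sub>v ((B\<^sub>Q * C) *\<^sub>v d t)"
        by (rule mat_mult_append[of _ n n]) (use L C BQ d in auto)
      have e2: "A\<^sub>E *\<^sub>v \<xi> t = ((A + B * F) *\<^sub>v h t + (B * C\<^sub>Q) *\<^sub>v q t) @\<^sub>v (0\<^sub>m r n *\<^sub>v h t + A\<^sub>Q *\<^sub>v q t)"
        unfolding A\<^sub>E_def hq by (rule four_block_mat_mult_vec) (use A B F AQ CQ h q in auto)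
      have m: "- (B\<^sub>Q * C) *\<^sub>v h t = - (B\<^sub>Q *\<^sub>v (C *\<^sub>v h t))"
        using BQ C h[of t] by (simp add: vec_expand)
      have z: "0\<^sub>m r n *\<^sub>v h t = 0\<^sub>v r" using h[of t] by auto
      show ?thesis unfolding hqs e1 e2 ys m z unfolding d_def using A B C F L AQ BQ CQ DQ h[of t] q[of t] x[of t]
        by (intro eq_vecI) (auto simp: vec_expand simp del: index_mult_mat_vec)
    qed
    have "z (Suc t) = ?Z *\<^sub>v z t" for t
    proof -
      have "?Z *\<^sub>v z t = ((A + L * C) *\<^sub>v d t + 0\<^sub>m n (n + r) *\<^sub>v \<xi> t) @\<^sub>v (?E *\<^sub>v d t + A\<^sub>E *\<^sub>v \<xi> t)"
        unfolding z_def by (rule four_block_mat_mult_vec[OF AL zero_carrier_mat E carriers(4) d \<xi>])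
      also have "0\<^sub>m n (n + r) *\<^sub>v \<xi> t = 0\<^sub>v n" using \<xi>[of t] by auto
      also have "(A + L * C) *\<^sub>v d t + 0\<^sub>v n = (A + L * C) *\<^sub>v d t" using AL d[of t] by simp
      finally show ?thesis by (simp add: z_def ds \<xi>z)
    qed
    moreover have "schur_stable ?Z" by (rule schur_stable_block(2)[OF AL carriers(4) sL AE_schur E])
    moreover have "?Z \<in> carrier_mat (n + (n + r)) (n + (n + r))" using AL carriers(4) by simp
    moreover have "z t \<in> carrier_vec (n + (n + r))" for t using d \<xi> by (simp add: z_def)
    ultimately have "vec_tendsto_zero (n + (n + r)) z" by (intro schur_stable_trajectory)
    then have lim: "(\<lambda>t. z t $ i) \<longlonglongrightarrow> 0" if "i < n + (n + r)" for i
      using that by (simp add: vec_tendsto_zero_def)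
    have "(\<lambda>t. \<xi> t $ i) \<longlonglongrightarrow> 0" if i: "i < n + r" for i
    proof -
      have "z t $ (n + i) = \<xi> t $ i" for t
        unfolding z_def using i carrier_vecD[OF d[of t]] carrier_vecD[OF \<xi>[of t]] by simp
      then show ?thesis using lim[of "n + i"] i by simp
    qed
    moreover have "(\<lambda>t. x t $ i) \<longlonglongrightarrow> 0" if i: "i < n" for i
    proof -
      have "x t $ i = z t $ i + z t $ (n + i)" for t
        unfolding z_def d_def hq using i x[of t] h[of t] q[of t] by simp
      then show ?thesis using tendsto_add[OF lim[of i] lim[of "n + i"]] i by simp
    qed
    ultimately show ?thesis by (simp add: vec_tendsto_zero_def)
  qed
  with wp show ?thesis unfolding internally_stable_loop_def by blast
qed

end

section \<open>The parametrization of stabilizing controllers\<close>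

text \<open>
  The observer-based controller whose free parameter is the Youla parameter of \<open>(X, Y)\<close> has the
  transfer matrix \<open>Y W (X W)^-1\<close>. As \<open>X W\<close> is invertible, so is \<open>X\<close>, and \<open>W\<close> cancels.
\<close>

lemma coprime_quotient_in_C_stab:
  assumes A: "A \<in> carrier_mat n n" and B: "B \<in> carrier_mat n m" and C: "C \<in> carrier_mat p n"
    and stabA: "stabilizable A B" and detA: "detectable C A"
    and M: "M \<in> RH_inf p p" and N: "N \<in> RH_inf p m" and X: "X \<in> RH_inf p p" and Y: "Y \<in> RH_inf m p"
    and bezout: "M * X - N * Y = 1\<^sub>m p" and MG: "M * transfer_matrix A B C (0\<^sub>m p m) = N"
  shows "Y * minv X \<in> C_stab n m p A B C"
proof -
  note cX = RH_inf_carrier[OF X] and cY = RH_inf_carrier[OF Y]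
  obtain F where F: "F \<in> carrier_mat m n" "schur_stable (A + B * F)"
    using stabA A B by (auto simp: stabilizable_def)
  obtain L where L: "L \<in> carrier_mat n p" "schur_stable (A + L * C)"
    using detA A C by (auto simp: detectable_def)
  obtain W x Q where W: "W \<in> carrier_mat p p" and x: "x \<in> carrier_mat n p" and Q: "Q \<in> RH_inf m p"
    and XW: "X * W = const_tmat C * x + 1\<^sub>m p" and YW: "Y * W = const_tmat F * x + Q"
    and zx: "indet_z \<cdot>\<^sub>m x = const_tmat (A + B * F) * x + (const_tmat B * Q - const_tmat L)"
    using youla_parameter[OF A B C F(1) L(1) F(2) L(2) M N X Y bezout MG] by blast
  obtain r A\<^sub>Q B\<^sub>Q C\<^sub>Q D\<^sub>Q where AQ: "A\<^sub>Q \<in> carrier_mat r r" and BQ: "B\<^sub>Q \<in> carrier_mat r p"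
    and CQ: "C\<^sub>Q \<in> carrier_mat m r" and DQ: "D\<^sub>Q \<in> carrier_mat m p" and sQ: "schur_stable A\<^sub>Q"
    and Q_eq: "Q = transfer_matrix A\<^sub>Q B\<^sub>Q C\<^sub>Q D\<^sub>Q"
    using RH_inf_schur_realizable[OF Q] unfolding schur_realizable_def by blast
  interpret oc: observer_controller n m p r A B C F L A\<^sub>Q B\<^sub>Q C\<^sub>Q D\<^sub>Q
    by unfold_locales (fact A B C F L AQ BQ CQ DQ sQ)+
  define K where "K = transfer_matrix oc.A\<^sub>K oc.B\<^sub>K oc.C\<^sub>K D\<^sub>Q"
  have K: "K \<in> carrier_mat m p" unfolding K_def by (rule transfer_matrix_carrier[OF oc.carriers(1-3) DQ])
  have YKX: "Y * W = K * (X * W)" and inv: "invertible_mat (X * W)"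
    unfolding XW YW K_def by (rule oc.controller_factorization[OF Q_eq x zx])+
  have cXW: "X * W \<in> carrier_mat p p" using cX W by simp
  define V where "V = W * minv (X * W)"
  have V: "V \<in> carrier_mat p p" using W minv_inverts(1)[OF cXW inv] by (simp add: V_def)
  have XV: "X * V = 1\<^sub>m p"
    using minv_inverts(1,2)[OF cXW inv] cX W by (simp add: V_def mat_expand)
  have VX: "minv X = V" by (rule minv_unique(2)[OF cX V XV])
  have "Y * V = Y * W * minv (X * W)"
    using minv_inverts(1)[OF cXW inv] cY W by (simp add: V_def mat_expand)
  also have "\<dots> = K * (X * W * minv (X * W))"
    unfolding YKX using minv_inverts(1)[OF cXW inv] K cX W by (simp add: mat_expand)
  also have "\<dots> = K" using minv_inverts(2)[OF cXW inv] K by simp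
  finally have "Y * minv X = transfer_matrix oc.A\<^sub>K oc.B\<^sub>K oc.C\<^sub>K D\<^sub>Q" by (simp add: VX K_def)
  with oc.carriers(1-3) DQ oc.stabilizable_controller oc.detectable_controller oc.internally_stable
  show ?thesis unfolding C_stab_def by blast
qed

lemma C_stab_coprime_quotient:
  assumes A: "A \<in> carrier_mat n n" and B: "B \<in> carrier_mat n m" and C: "C \<in> carrier_mat p n"
    and M: "M \<in> carrier_mat p p" and N: "N \<in> carrier_mat p m" and U: "U \<in> RH_inf p p" and V: "V \<in> RH_inf m p"
    and bezout: "M * U - N * V = 1\<^sub>m p" and MG: "M * transfer_matrix A B C (0\<^sub>m p m) = N"
    and K: "K \<in> C_stab n m p A B C"
  shows "\<exists>X Y. K = Y * minv X \<and> M * X - N * Y = 1\<^sub>m p \<and> X \<in> RH_inf p p \<and> Y \<in> RH_inf m p"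
proof -
  obtain q A\<^sub>K B\<^sub>K C\<^sub>K D\<^sub>K where AK: "A\<^sub>K \<in> carrier_mat q q" and BK: "B\<^sub>K \<in> carrier_mat q p"
    and CK: "C\<^sub>K \<in> carrier_mat m q" and DK: "D\<^sub>K \<in> carrier_mat m p"
    and K_eq: "K = transfer_matrix A\<^sub>K B\<^sub>K C\<^sub>K D\<^sub>K"
    and stab: "internally_stable_loop n m p q A B C A\<^sub>K B\<^sub>K C\<^sub>K D\<^sub>K"
    using K unfolding C_stab_def by blast
  have cK: "K \<in> carrier_mat m p" unfolding K_eq by (rule transfer_matrix_carrier[OF AK BK CK DK])
  obtain X Y where XY: "X \<in> RH_inf p p" "Y \<in> RH_inf m p" "M * X - N * Y = 1\<^sub>m p" "Y = K * X"
    using stabilizing_controller_factor[OF A B C AK BK CK DK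
        closed_loop_schur[OF A B C AK BK CK DK stab] U V N M bezout MG]
    unfolding K_eq by blast
  have "K = Y * minv X" by (rule factor_invertible(2)[OF M RH_inf_carrier[OF XY(1)] cK N XY(3,4)])
  with XY show ?thesis by blast
qed

theorem theorem1:
  fixes n m p :: nat
    and A\<^sub>p B\<^sub>p C\<^sub>p :: "real mat"
    and U\<^sub>l V\<^sub>l N\<^sub>l M\<^sub>l U\<^sub>r V\<^sub>r N\<^sub>r M\<^sub>r :: tmat
  assumes "A\<^sub>p \<in> carrier_mat n n" and "B\<^sub>p \<in> carrier_mat n m" and "C\<^sub>p \<in> carrier_mat p n"
    and "stabilizable A\<^sub>p B\<^sub>p" and "detectable C\<^sub>p A\<^sub>p"
    and "doubly_coprime_factorization p m (transfer_matrix A\<^sub>p B\<^sub>p C\<^sub>p (0\<^sub>m p m))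
           U\<^sub>l V\<^sub>l N\<^sub>l M\<^sub>l U\<^sub>r V\<^sub>r N\<^sub>r M\<^sub>r"
  shows "C_stab n m p A\<^sub>p B\<^sub>p C\<^sub>p =
    {K. \<exists>X Y. K = Y * minv X \<and> M\<^sub>l * X - N\<^sub>l * Y = 1\<^sub>m p \<and> X \<in> RH_inf p p \<and> Y \<in> RH_inf m p}"
proof -
  note bezout = doubly_coprime_factorizationD[OF assms(6)]
  have RH: "M\<^sub>l \<in> RH_inf p p" "N\<^sub>l \<in> RH_inf p m" "U\<^sub>r \<in> RH_inf p p" "V\<^sub>r \<in> RH_inf m p"
    using assms(6) unfolding doubly_coprime_factorization_def by blast+
  show ?thesis
    using C_stab_coprime_quotient[OF assms(1-3) RH_inf_carrier[OF RH(1)] RH_inf_carrier[OF RH(2)] RH(3,4) bezout]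
      coprime_quotient_in_C_stab[OF assms(1-5) RH(1,2) _ _ _ bezout(2)]
    by blast
qed

end
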